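(* Let $D\in\mathbb{R}^{N\times P}$, let $J_0:\mathbb{R}^P\to\mathbb{R}$ be a finite-valued convex function, let $x\in\mathbb{R}^N$ and $u=D^*x$. Suppose that $J_0\in \mathrm{PSFL}_u(\Gamma_0,f_0,\nu_{0,u},\mu_{0,u},\tau_{0,u},\xi_{0,u})$. Let $J=J_0\circ D^*$, let $T=T_x=S^\perp$ be the model subspace of $J$ at $x$ and $T_0=S_0^\perp$ the model subspace of $J_0$ at $u$, and write $D_{S_0}=DP_{S_0}$. Then, with the choice $f_{x'}=Df_{0,D^*x'}$ and with $\Gamma$ any finite-valued gauge which is coercive on $T$, one has $J\in \mathrm{PSFL}_x(\Gamma,f,\nu_x,\mu_x,\tau_x,\xi_x)$ with $$\nu_x=\frac{\nu_{0,u}}{|||D^*|||_{\Gamma\to\Gamma_0}},\qquad \mu_x=\mu_{0,u}\,|||P_TD|||_{\Gamma_0\to\Gamma}\,|||D^*|||_{\Gamma\to\Gamma_0},$$ $$\tau_x=\Big(\tau_{0,u}\,|||D_{S_0}^+P_SD|||_{J_{0,f_{0,u}}^{u,\circ}\to J_{0,f_{0,u}}^{u,\circ}}+\mu_{0,u}\,|||D_{S_0}^+P_SD|||_{\Gamma_0\to J_{0,f_{0,u}}^{u,\circ}}\Big)|||D^*|||_{\Gamma\to\Gamma_0},$$ $$\xi_x=\xi_{0,u}\,|||D^*|||_{\Gamma\to\Gamma_0}.$$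
   Context: Model subspace: for a finite-valued convex $J$ on $\mathbb{R}^n$ and $x\in\mathbb{R}^n$, $\bar S_x$ is the affine hull of $\partial J(x)$; $e_x$ is the orthogonal projection of $0$ onto $\bar S_x$; $S_x=\bar S_x-e_x$ (a linear subspace); $T_x=S_x^\perp$. Quantities attached to $J_0$ carry a subscript $0$. $P_V$ is the orthogonal projector onto $V$; $A^+$ is the Moore–Penrose pseudo-inverse. Gauges: for a closed convex $C\ni0$, $\gamma_C(u)=\inf\{\lambda>0:u\in\lambda C\}$ ($\inf\emptyset=+\infty$). For $f_x\in\operatorname{ri}\partial J(x)$ the subdifferential gauge is $J_{f_x}^{x,\circ}=\gamma_{\partial J(x)-f_x}$ (finite and coercive on $S_x$, $+\infty$ elsewhere). A gauge is coercive on a subspace if it tends to $+\infty$ as the norm of its argument in that subspace tends to infinity. Operator bound: for gauges $\Gamma_1,\Gamma_2$ finite on subspaces $V_1,V_2$ and linear $A:V_1\to V_2$, $|||A|||_{\Gamma_1\to\Gamma_2}=\sup_{v\in V_1,\ \Gamma_1(v)\le1}\Gamma_2(Av)$; here $\Gamma$ is considered on $T$, $\Gamma_0$ on $T_0$, and $J_{0,f_{0,u}}^{u,\circ}$ (the subdifferential gauge of $J_0$ at $u$ for $f_{0,u}$) on $S_0$, the operators being restricted accordingly. If $|||D^*|||_{\Gamma\to\Gamma_0}=0$, $\nu_x$ may be taken to be any non-negative real. Partial smoothness: a finite-valued convex $J$ is partly smooth at $x$ relative to a set $\mathcal M\ni x$ if (1) $\mathcal M$ is a $C^2$-manifold around $x$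 and $J$ restricted to $\mathcal M$ is $C^2$ around $x$; (2) the tangent space of $\mathcal M$ at $x$ is $T_x$; (3) the set-valued map $\partial J$ is continuous at $x$ relative to $\mathcal M$. The class $\mathrm{PSFL}_x(\Gamma,f,\nu_x,\mu_x,\tau_x,\xi_x)$: $\Gamma$ is a gauge that is finite and coercive on $T_x$; $\nu_x,\mu_x,\tau_x,\xi_x$ are non-negative reals; $J$ is finite-valued, convex, partly smooth at $x$ relative to $\mathcal M=T_x$; $\partial J$ is Lipschitz-continuous around $x$ relative to $T_x$ (there are $\beta\ge0$ and a neighbourhood $U$ of $x$ with $\partial J(z')\subseteq\partial J(z)+\beta\|z-z'\|\mathbb B$ for all $z,z'\in T_x\cap U$, $\mathbb B$ the closed unit ball); $f:x'\mapsto f_{x'}\in\operatorname{ri}\partial J(x')$ is a Lipschitz-continuous map on a neighbourhood of $x$ in $T_x$ containing all $x'\in T_x$ with $\Gamma(x-x')<\nu_x$; and, with $S=S_x$: for every $x'\in T_x$ with $\Gamma(x-x')\le\nu_x$ one has $T_{x'}=T_x$, and for every $x'\in T_x$ with $\Gamma(x-x')<\nu_x$, $$\Gamma(e_x-e_{x'})\le\mu_x\Gamma(x-x'),\qquad J_{f_x}^{x,\circ}(P_S(f_x-f_{x'}))\le\tau_x\Gamma(x-x'),\qquad \sup_{v\in S,\,v\ne0}\frac{J_{f_{x'}}^{x',\circ}(v)-J_{f_x}^{x,\circ}(v)}{J_{f_x}^{x,\circ}(v)}\le\xi_x\Gamma(x-x').$$ *)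

theory Defs
  imports "HOL-Analysis.Analysis"
begin

definition subdifferential :: "('a::euclidean_space \<Rightarrow> real) \<Rightarrow> 'a \<Rightarrow> 'a set" where
  "subdifferential J x = {g. \<forall>y. J y \<ge> J x + g \<bullet> (y - x)}"

(* For a finite-valued convex J the subdifferential is nonempty, so that closest_point
   below is the genuine orthogonal projection onto an affine subspace. The orthogonal
   projector onto a linear subspace V is written closest_point V throughout. *)

definition model_vector :: "('a::euclidean_space \<Rightarrow> real) \<Rightarrow> 'a \<Rightarrow> 'a" where
  "model_vector J x = closest_point (affine hull subdifferential J x) 0"

definition model_S :: "('a::euclidean_space \<Rightarrow> real) \<Rightarrow> 'a \<Rightarrow> 'a set" where
  "model_S J x = (\<lambda>g. g - model_vector J x) ` (affine hull subdifferential J x)"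

definition model_T :: "('a::euclidean_space \<Rightarrow> real) \<Rightarrow> 'a \<Rightarrow> 'a set" where
  "model_T J x = (model_S J x)\<^sup>\<bottom>"

(* In ereal the infimum of the empty set is \<infinity>. *)

definition minkowski_gauge :: "'a::euclidean_space set \<Rightarrow> 'a \<Rightarrow> ereal" where
  "minkowski_gauge C u = Inf {ereal l | l. l > 0 \<and> u \<in> (\<lambda>c. l *\<^sub>R c) ` C}"

definition is_gauge :: "('a::euclidean_space \<Rightarrow> ereal) \<Rightarrow> bool" where
  "is_gauge \<Gamma> \<longleftrightarrow> (\<exists>C. closed C \<and> convex C \<and> 0 \<in> C \<and> \<Gamma> = minkowski_gauge C)"

definition finite_on :: "'a set \<Rightarrow> ('a \<Rightarrow> ereal) \<Rightarrow> bool" where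
  "finite_on V \<Gamma> \<longleftrightarrow> (\<forall>v\<in>V. \<bar>\<Gamma> v\<bar> \<noteq> \<infinity>)"

definition coercive_on :: "'a::euclidean_space set \<Rightarrow> ('a \<Rightarrow> ereal) \<Rightarrow> bool" where
  "coercive_on V \<Gamma> \<longleftrightarrow> (\<Gamma> \<longlongrightarrow> \<infinity>) (inf at_infinity (principal V))"

(* The subdifferential gauge at x, based at g (meant for g in the relative interior of
   the subdifferential). *)

definition subdiff_gauge :: "('a::euclidean_space \<Rightarrow> real) \<Rightarrow> 'a \<Rightarrow> 'a \<Rightarrow> 'a \<Rightarrow> ereal" where
  "subdiff_gauge J x g = minkowski_gauge ((\<lambda>h. h - g) ` subdifferential J x)"

(* The bound of A restricted to V1; the target subspace V2, on which G2 is finite, only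
   has to contain the image A ` V1 and does not enter the formula. *)

definition op_bound ::
    "'a set \<Rightarrow> ('a \<Rightarrow> ereal) \<Rightarrow> ('b \<Rightarrow> ereal) \<Rightarrow> ('a \<Rightarrow> 'b) \<Rightarrow> ereal" where
  "op_bound V1 G1 G2 A = (SUP v\<in>{v\<in>V1. G1 v \<le> 1}. G2 (A v))"

definition pinv :: "real^'n^'m \<Rightarrow> real^'m^'n" where
  "pinv A = (THE X. A ** X ** A = A \<and> X ** A ** X = X \<and>
     transpose (A ** X) = A ** X \<and> transpose (X ** A) = X ** A)"

definition C2_on :: "'a::euclidean_space set \<Rightarrow> ('a \<Rightarrow> 'b::real_normed_vector) \<Rightarrow> bool" where
  "C2_on U f \<longleftrightarrow>
     (\<exists>(f' :: 'a \<Rightarrow> 'a \<Rightarrow>\<^sub>L 'b) (f'' :: 'a \<Rightarrow> 'a \<Rightarrow>\<^sub>L ('a \<Rightarrow>\<^sub>L 'b)).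
        (\<forall>z\<in>U. (f has_derivative blinfun_apply (f' z)) (at z)) \<and>
        (\<forall>z\<in>U. (f' has_derivative blinfun_apply (f'' z)) (at z)) \<and>
        continuous_on U f'')"

(* Near x, a C2 diffeomorphism straightens M to a linear subspace L. *)

definition C2_manifold_around :: "'a::euclidean_space set \<Rightarrow> 'a \<Rightarrow> bool" where
  "C2_manifold_around M x \<longleftrightarrow>
     (\<exists>U V (L :: 'a set) \<Phi> \<Psi>. open U \<and> x \<in> U \<and> open V \<and> subspace L \<and>
        homeomorphism U V \<Phi> \<Psi> \<and> C2_on U \<Phi> \<and> C2_on V \<Psi> \<and> \<Phi> ` (M \<inter> U) = V \<inter> L)"

definition C2_around_rel :: "('a::euclidean_space \<Rightarrow> real) \<Rightarrow> 'a \<Rightarrow> 'a set \<Rightarrow> bool" where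
  "C2_around_rel J x M \<longleftrightarrow>
     (\<exists>U g. open U \<and> x \<in> U \<and> C2_on U g \<and> (\<forall>z\<in>M \<inter> U. J z = g z))"

definition tangent_space :: "'a::euclidean_space set \<Rightarrow> 'a \<Rightarrow> 'a set" where
  "tangent_space M x =
     {v. \<exists>\<epsilon>>0. \<exists>c. c C1_differentiable_on {-\<epsilon><..<\<epsilon>} \<and> c 0 = x \<and>
           (\<forall>t\<in>{-\<epsilon><..<\<epsilon>}. c t \<in> M) \<and> (c has_vector_derivative v) (at 0)}"

(* Continuity of a set-valued map in the Painleve-Kuratowski sense:
   the outer limit is contained in F x, which is contained in the inner limit. *)

definition setvalued_continuous_rel ::
    "('a::euclidean_space \<Rightarrow> 'b::euclidean_space set) \<Rightarrow> 'a \<Rightarrow> 'a set \<Rightarrow> bool" where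
  "setvalued_continuous_rel F x M \<longleftrightarrow>
     (\<forall>z y l. (\<forall>n::nat. z n \<in> M \<and> y n \<in> F (z n)) \<longrightarrow> z \<longlonglongrightarrow> x \<longrightarrow> y \<longlonglongrightarrow> l \<longrightarrow> l \<in> F x) \<and>
     (\<forall>l\<in>F x. \<forall>z. (\<forall>n::nat. z n \<in> M) \<longrightarrow> z \<longlonglongrightarrow> x \<longrightarrow>
        (\<exists>y. y \<longlonglongrightarrow> l \<and> (\<forall>\<^sub>F n in sequentially. y n \<in> F (z n))))"

definition partly_smooth :: "('a::euclidean_space \<Rightarrow> real) \<Rightarrow> 'a \<Rightarrow> 'a set \<Rightarrow> bool" where
  "partly_smooth J x M \<longleftrightarrow>
     convex_on UNIV J \<and> x \<in> M \<and>
     C2_manifold_around M x \<and> C2_around_rel J x M \<and>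
     tangent_space M x = model_T J x \<and>
     setvalued_continuous_rel (subdifferential J) x M"

definition setvalued_lipschitz_around_rel ::
    "('a::euclidean_space \<Rightarrow> 'a set) \<Rightarrow> 'a \<Rightarrow> 'a set \<Rightarrow> bool" where
  "setvalued_lipschitz_around_rel F x M \<longleftrightarrow>
     (\<exists>\<beta>\<ge>0. \<exists>U. open U \<and> x \<in> U \<and>
        (\<forall>z\<in>M \<inter> U. \<forall>z'\<in>M \<inter> U.
           F z' \<subseteq> {g + h | g h. g \<in> F z \<and> h \<in> cball 0 (\<beta> * norm (z - z'))}))"

(* f is a total function; only its values on the neighbourhood W of x in the model
   subspace matter. *)

definition PSFL :: "('a::euclidean_space \<Rightarrow> real) \<Rightarrow> 'a \<Rightarrow> ('a \<Rightarrow> ereal) \<Rightarrow> ('a \<Rightarrow> 'a) \<Rightarrow>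
    real \<Rightarrow> real \<Rightarrow> real \<Rightarrow> real \<Rightarrow> bool" where
  "PSFL J x \<Gamma> f \<nu> \<mu> \<tau> \<xi> \<longleftrightarrow>
     (let S = model_S J x; T = model_T J x; e = model_vector J in
       is_gauge \<Gamma> \<and> finite_on T \<Gamma> \<and> coercive_on T \<Gamma> \<and>
       0 \<le> \<nu> \<and> 0 \<le> \<mu> \<and> 0 \<le> \<tau> \<and> 0 \<le> \<xi> \<and>
       convex_on UNIV J \<and>
       partly_smooth J x T \<and>
       setvalued_lipschitz_around_rel (subdifferential J) x T \<and>
       (\<exists>W U L. open U \<and> x \<in> U \<and> T \<inter> U \<subseteq> W \<and> W \<subseteq> T \<and>
          {x'\<in>T. \<Gamma> (x - x') < ereal \<nu>} \<subseteq> W \<and>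
          (\<forall>x'\<in>W. f x' \<in> rel_interior (subdifferential J x')) \<and>
          L-lipschitz_on W f) \<and>
       (\<forall>x'\<in>T. \<Gamma> (x - x') \<le> ereal \<nu> \<longrightarrow> model_T J x' = T) \<and>
       (\<forall>x'\<in>T. \<Gamma> (x - x') < ereal \<nu> \<longrightarrow>
          \<Gamma> (e x - e x') \<le> ereal \<mu> * \<Gamma> (x - x') \<and>
          subdiff_gauge J x (f x) (closest_point S (f x - f x')) \<le> ereal \<tau> * \<Gamma> (x - x') \<and>
          (SUP v\<in>S - {0}.
             (subdiff_gauge J x' (f x') v - subdiff_gauge J x (f x) v)
               / subdiff_gauge J x (f x) v) \<le> ereal \<xi> * \<Gamma> (x - x')))"

end

theory Submission
  imports Defs
begin

text \<open>
  Write \<open>A\<close> for the adjoint of \<open>D\<close>, so that \<open>J = J0 \<circ> A\<close> and \<open>u = A x\<close>. The chain rule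
  \<open>\<partial>J(y) = D \<partial>J0(A y)\<close> (\<open>subdifferential_comp_adjoint\<close>) makes the whole model geometry of \<open>J\<close> an image
  of that of \<open>J0\<close>: \<open>S = D S0\<close>, \<open>T\<close> is the preimage of \<open>T0\<close> under \<open>A\<close>, and \<open>D e\<^sub>0\<close> lies in the affine
  hull of \<open>\<partial>J(x)\<close>, so that \<open>e = P_T D e\<^sub>0\<close>. Since \<open>A\<close> maps \<open>T\<close> into \<open>T0\<close>, each regularity property of
  \<open>J0\<close> along \<open>T0\<close> pulls back to \<open>J\<close> along \<open>T\<close>.

  The constants then come from four estimates at a point \<open>x'\<close> of \<open>T\<close> with image \<open>u' = A x'\<close>.

  \<^item> Region: \<open>\<Gamma>0 (u - u') \<le> |||A||| \<Gamma> (x - x')\<close>, so if \<open>|||A||| > 0\<close> then the \<open>\<nu>\<close>-region around \<open>x\<close> is mapped into the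
    \<open>\<nu>0\<close>-region around \<open>u\<close>. If \<open>|||A||| = 0\<close>, then coercivity of \<open>\<Gamma>0\<close> forces \<open>A\<close> to vanish on \<open>T\<close>,
    hence \<open>u' = u\<close>, and any \<open>\<nu>\<close> will do.

  \<^item> Model vectors: \<open>e\<^sub>x - e\<^sub>x\<^sub>' = P_T D (e\<^sub>0\<^sub>,\<^sub>u - e\<^sub>0\<^sub>,\<^sub>u\<^sub>')\<close>.

  \<^item> Subgradients: the gauge of \<open>J\<close> at \<open>D w\<close> is at most the gauge of \<open>J0\<close> at \<open>w\<close>, and \<open>D_S0\<^sup>+\<close> provides a
    preimage in \<open>S0\<close> of any vector of \<open>S\<close>. The difference \<open>f0 u - f0 u'\<close> splits into its \<open>S0\<close>-part,
    controlled by \<open>\<tau>0\<close>, and its \<open>T0\<close>-part, which is the difference of the model vectors of \<open>J0\<close> and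
    so is controlled by \<open>\<mu>0\<close>. This is where the two summands of \<open>\<tau>\<close> come from.

  \<^item> Gauges: at a nonzero \<open>v\<close> in \<open>S\<close>, the gauge of \<open>J\<close> equals that of \<open>J0\<close> at a suitable preimage
    \<open>w\<close> of \<open>v\<close> in \<open>S0\<close>, and comparing at this \<open>w\<close> shows that the relative excess of one gauge over another cannot
    grow under \<open>D\<close> (\<open>excess_ratio_comp_adjoint\<close>).

  All operator bounds are finite, because a gauge that is finite on a subspace is dominated by a
  multiple of the norm there and a coercive one dominates such a multiple (\<open>op_bound_finite\<close>).

  The argument is carried out for an arbitrary linear map \<open>D\<close> between Euclidean spaces and an
  arbitrary linear map \<open>Q\<close> in place of \<open>D_S0\<^sup>+\<close> that sends \<open>S\<close> into \<open>S0\<close> and is inverted there by \<open>D\<close>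
  (\<open>PSFL_comp_adjoint\<close>). That the Moore--Penrose inverse exists and has these properties is shown
  separately.
\<close>

section \<open>Gauges\<close>

lemma minkowski_gauge_nonneg: "0 \<le> minkowski_gauge C u"
  unfolding minkowski_gauge_def by (rule Inf_greatest) auto

lemma minkowski_gauge_le:
  assumes "0 < l" "u \<in> (\<lambda>c. l *\<^sub>R c) ` C"
  shows "minkowski_gauge C u \<le> ereal l"
  unfolding minkowski_gauge_def using assms by (intro Inf_lower) auto

lemma minkowski_gauge_zero:
  assumes "0 \<in> C"
  shows "minkowski_gauge C 0 = 0"
proof (rule antisym[OF _ minkowski_gauge_nonneg])
  have "minkowski_gauge C 0 \<le> 0 + ereal e" if "0 < e" for e
    using minkowski_gauge_le[OF that, of 0 C] assms by force
  then show "minkowski_gauge C 0 \<le> 0"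
    by (rule ereal_le_epsilon2)
qed

text \<open>The infimum need not be attained, so a finite gauge value is used through the strict upper bounds
  that it satisfies.\<close>

lemma minkowski_gauge_lessD:
  assumes "minkowski_gauge C u < ereal r"
  obtains l c where "0 < l" "l < r" "u = l *\<^sub>R c" "c \<in> C"
  using assms unfolding minkowski_gauge_def Inf_less_iff by auto

lemma minkowski_gauge_cases:
  obtains "minkowski_gauge C u = \<infinity>" | r where "0 \<le> r" "minkowski_gauge C u = ereal r"
  using minkowski_gauge_nonneg[of C u] by (cases "minkowski_gauge C u") auto

lemma minkowski_gauge_scaleR_le:
  assumes "0 < a"
  shows "minkowski_gauge C (a *\<^sub>R u) \<le> ereal a * minkowski_gauge C u"
proof (cases rule: minkowski_gauge_cases[of C u])
  case 1
  then show ?thesis using assms by simp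
next
  case (2 r)
  have "minkowski_gauge C (a *\<^sub>R u) \<le> ereal (a * r) + ereal e" if "0 < e" for e
  proof -
    have "minkowski_gauge C u < ereal (r + e / a)"
      using 2 that assms by simp
    then obtain l c where l: "0 < l" "l < r + e / a" "u = l *\<^sub>R c" "c \<in> C"
      by (rule minkowski_gauge_lessD)
    then have "minkowski_gauge C (a *\<^sub>R u) \<le> ereal (a * l)"
      using assms by (intro minkowski_gauge_le) auto
    also have "\<dots> \<le> ereal (a * r + e)"
      using l(2) assms by (simp add: field_simps)
    finally show ?thesis by simp
  qed
  then have "minkowski_gauge C (a *\<^sub>R u) \<le> ereal (a * r)"
    by (rule ereal_le_epsilon2)
  then show ?thesis using 2 by simp
qed

lemma minkowski_gauge_scaleR:
  assumes "0 < a"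
  shows "minkowski_gauge C (a *\<^sub>R u) = ereal a * minkowski_gauge C u"
proof (rule antisym[OF minkowski_gauge_scaleR_le[OF assms]])
  have "minkowski_gauge C ((1 / a) *\<^sub>R a *\<^sub>R u) \<le> ereal (1 / a) * minkowski_gauge C (a *\<^sub>R u)"
    using assms by (intro minkowski_gauge_scaleR_le) simp
  then have "minkowski_gauge C u \<le> ereal (1 / a) * minkowski_gauge C (a *\<^sub>R u)"
    using assms by simp
  then have "ereal a * minkowski_gauge C u \<le> ereal a * (ereal (1 / a) * minkowski_gauge C (a *\<^sub>R u))"
    using assms by (intro ereal_mult_left_mono) auto
  also have "\<dots> = minkowski_gauge C (a *\<^sub>R u)"
    using assms by (simp flip: mult.assoc)
  finally show "ereal a * minkowski_gauge C u \<le> minkowski_gauge C (a *\<^sub>R u)" .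
qed

lemma minkowski_gauge_add:
  assumes "convex C"
  shows "minkowski_gauge C (u + v) \<le> minkowski_gauge C u + minkowski_gauge C v"
proof (cases rule: minkowski_gauge_cases[of C u]; cases rule: minkowski_gauge_cases[of C v])
  fix r s assume *: "minkowski_gauge C u = ereal r" "minkowski_gauge C v = ereal s"
  have "minkowski_gauge C (u + v) \<le> ereal (r + s) + ereal e" if "0 < e" for e
  proof -
    have "minkowski_gauge C u < ereal (r + e / 2)" "minkowski_gauge C v < ereal (s + e / 2)"
      using * \<open>0 < e\<close> by simp_all
    then obtain l c k d
      where l: "0 < l" "l < r + e / 2" "u = l *\<^sub>R c" "c \<in> C"
        and k: "0 < k" "k < s + e / 2" "v = k *\<^sub>R d" "d \<in> C"
      by (elim minkowski_gauge_lessD)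
    \<comment> \<open>The sum of a point of \<open>l C\<close> and a point of \<open>k C\<close> lies in \<open>(l + k) C\<close>.\<close>
    have "(l / (l + k)) *\<^sub>R c + (k / (l + k)) *\<^sub>R d \<in> C"
      using l k by (intro convexD[OF assms]) (auto simp flip: add_divide_distrib)
    moreover have "u + v = (l + k) *\<^sub>R ((l / (l + k)) *\<^sub>R c + (k / (l + k)) *\<^sub>R d)"
      using l k by (simp add: scaleR_add_right)
    ultimately have "minkowski_gauge C (u + v) \<le> ereal (l + k)"
      using l k by (intro minkowski_gauge_le) auto
    also have "\<dots> \<le> ereal (r + s + e)"
      using l k by simp
    finally show ?thesis by simp
  qed
  then have "minkowski_gauge C (u + v) \<le> ereal (r + s)"
    by (rule ereal_le_epsilon2)
  then show ?thesis using * by simp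
qed auto

text \<open>Scaling factors \<open>l\<close> that decrease to the gauge value \<open>r\<close> put the points \<open>u / l\<close> into \<open>C\<close>; as \<open>r\<close> is
  positive, these converge to \<open>u / r\<close>.\<close>

lemma minkowski_gauge_attained:
  assumes "closed C" "minkowski_gauge C u = ereal r" "0 < r"
  shows "u \<in> (\<lambda>c. r *\<^sub>R c) ` C"
proof -
  have "\<exists>l. 0 < l \<and> l < r + 1 / Suc n \<and> (1 / l) *\<^sub>R u \<in> C" for n
  proof -
    have "minkowski_gauge C u < ereal (r + 1 / Suc n)"
      using assms by simp
    then obtain l c where "0 < l" "l < r + 1 / Suc n" "u = l *\<^sub>R c" "c \<in> C"
      by (rule minkowski_gauge_lessD)
    then show ?thesis by (intro exI[of _ l]) auto
  qed
  then obtain l where l: "\<And>n. 0 < l n" "\<And>n. l n < r + 1 / Suc n" "\<And>n. (1 / l n) *\<^sub>R u \<in> C"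
    by metis
  have ge: "r \<le> l n" for n
  proof -
    have "minkowski_gauge C u \<le> ereal (l n)"
      using l[of n] by (intro minkowski_gauge_le image_eqI[where x = "(1 / l n) *\<^sub>R u"]) auto
    then show ?thesis using assms by simp
  qed
  have "l \<longlonglongrightarrow> r"
  proof (rule tendsto_sandwich[of "\<lambda>_. r" _ _ "\<lambda>n. r + 1 / Suc n"])
    show "(\<lambda>n. r + 1 / Suc n) \<longlonglongrightarrow> r"
      using LIMSEQ_Suc[OF lim_1_over_n, THEN tendsto_add[OF tendsto_const[of r]]] by simp
  qed (use ge l in \<open>auto intro!: always_eventually simp: less_imp_le\<close>)
  then have "(\<lambda>n. (1 / l n) *\<^sub>R u) \<longlonglongrightarrow> (1 / r) *\<^sub>R u"
    using assms by (intro tendsto_intros) auto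
  then have "(1 / r) *\<^sub>R u \<in> C"
    by (rule closed_sequentially[OF assms(1) l(3)])
  then show ?thesis
    using assms by (intro image_eqI[where x = "(1 / r) *\<^sub>R u"]) auto
qed

lemma minkowski_gauge_linear_image:
  assumes "linear D"
  shows "minkowski_gauge (D ` C) (D w) \<le> minkowski_gauge C w"
  unfolding minkowski_gauge_def
proof (rule Inf_superset_mono, clarify)
  fix l :: real and c assume "0 < l" "c \<in> C"
  then show "\<exists>k. ereal l = ereal k \<and> 0 < k \<and> D (l *\<^sub>R c) \<in> (\<lambda>c. k *\<^sub>R c) ` D ` C"
    using linear_scale[OF assms] by (intro exI[of _ l]) auto
qed

lemma norm_le_minkowski_gauge:
  assumes "0 < K" "C \<subseteq> cball 0 K"
  shows "ereal (norm v) \<le> ereal K * minkowski_gauge C v"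
proof (cases rule: minkowski_gauge_cases[of C v])
  case 1
  then show ?thesis using assms by simp
next
  case (2 r)
  have "norm v \<le> K * r + e" if "0 < e" for e
  proof -
    have "minkowski_gauge C v < ereal (r + e / K)"
      using 2 that assms by simp
    then obtain l c where l: "0 < l" "l < r + e / K" "v = l *\<^sub>R c" "c \<in> C"
      by (rule minkowski_gauge_lessD)
    then have "norm v \<le> l * K"
      using assms by auto
    also have "\<dots> \<le> (r + e / K) * K"
      using l assms by (intro mult_right_mono) auto
    also have "\<dots> = K * r + e"
      using assms by (simp add: field_simps)
    finally show ?thesis .
  qed
  then have "norm v \<le> K * r"
    by (rule field_le_epsilon)
  then show ?thesis using 2 by simp
qed

lemma minkowski_gauge_finite_linear:
  assumes "subspace V" "0 < r" "cball 0 r \<inter> V \<subseteq> C" "v \<in> V"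
  shows "minkowski_gauge C v < \<infinity>"
proof (cases "v = 0")
  case True
  have "0 \<in> C" using assms by (auto simp: subspace_0)
  then show ?thesis using True by (simp add: minkowski_gauge_zero)
next
  case False
  have "(r / norm v) *\<^sub>R v \<in> C"
    using assms False by (intro subsetD[OF assms(3)]) (auto simp: subspace_scale)
  then have "minkowski_gauge C v \<le> ereal (norm v / r)"
    using assms False by (intro minkowski_gauge_le image_eqI[where x = "(r / norm v) *\<^sub>R v"]) auto
  also have "\<dots> < \<infinity>" by simp
  finally show ?thesis .
qed


lemma gauge_nonneg: "is_gauge \<Gamma> \<Longrightarrow> 0 \<le> \<Gamma> v"
  by (auto simp: is_gauge_def minkowski_gauge_nonneg)

lemma gauge_zero: "is_gauge \<Gamma> \<Longrightarrow> \<Gamma> 0 = 0"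
  by (auto simp: is_gauge_def minkowski_gauge_zero)

lemma gauge_scaleR: "is_gauge \<Gamma> \<Longrightarrow> 0 < a \<Longrightarrow> \<Gamma> (a *\<^sub>R v) = ereal a * \<Gamma> v"
  by (auto simp: is_gauge_def minkowski_gauge_scaleR)

lemma gauge_add: "is_gauge \<Gamma> \<Longrightarrow> \<Gamma> (u + v) \<le> \<Gamma> u + \<Gamma> v"
  by (auto simp: is_gauge_def minkowski_gauge_add)

lemma gauge_sum:
  assumes "is_gauge \<Gamma>" "finite B"
  shows "\<Gamma> (\<Sum>b\<in>B. h b) \<le> (\<Sum>b\<in>B. \<Gamma> (h b))"
  using assms(2)
proof induction
  case empty
  then show ?case by (simp add: gauge_zero[OF assms(1)])
next
  case (insert b B)
  have "\<Gamma> (h b + (\<Sum>b\<in>B. h b)) \<le> \<Gamma> (h b) + \<Gamma> (\<Sum>b\<in>B. h b)"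
    by (rule gauge_add[OF assms(1)])
  also have "\<dots> \<le> \<Gamma> (h b) + (\<Sum>b\<in>B. \<Gamma> (h b))"
    by (intro add_left_mono insert.IH)
  finally show ?case using insert by simp
qed

lemma finite_on_realE:
  assumes "is_gauge \<Gamma>" "finite_on V \<Gamma>" "v \<in> V"
  obtains r where "0 \<le> r" "\<Gamma> v = ereal r"
  using assms gauge_nonneg[OF assms(1), of v] unfolding finite_on_def
  by (cases "\<Gamma> v") force+

text \<open>A gauge is sublinear, so its values at the vectors \<open>\<plusminus>b\<close> of an orthonormal basis bound it by a
  multiple of the norm.\<close>

lemma finite_gauge_le_norm:
  fixes \<Gamma> :: "'a::euclidean_space \<Rightarrow> ereal"
  assumes \<Gamma>: "is_gauge \<Gamma>" and V: "subspace V" and fin: "finite_on V \<Gamma>"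
  obtains M where "0 \<le> M" "\<And>v. v \<in> V \<Longrightarrow> \<Gamma> v \<le> ereal (M * norm v)"
proof -
  obtain B where B: "B \<subseteq> V" "pairwise orthogonal B" "\<And>b. b \<in> B \<Longrightarrow> norm b = 1"
      "independent B" "span B = V"
    using orthonormal_basis_subspace[OF V] by metis
  have finB: "finite B" using B(4) by (simp add: independent_imp_finite)
  define m where "m b = max (real_of_ereal (\<Gamma> b)) (real_of_ereal (\<Gamma> (- b)))" for b
  have "\<Gamma> b \<le> ereal (m b)" "\<Gamma> (- b) \<le> ereal (m b)" if "b \<in> B" for b
  proof -
    have "b \<in> V" "- b \<in> V" using that B V by (auto simp: subspace_neg)
    then show "\<Gamma> b \<le> ereal (m b)" "\<Gamma> (- b) \<le> ereal (m b)"
      using finite_on_realE[OF \<Gamma> fin] unfolding m_def by (metis ereal_less_eq(3) max.cobounded1 max.cobounded2 real_of_ereal.simps(1))+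
  qed
  note m = this
  have m0: "0 \<le> m b" for b
    unfolding m_def by (simp add: gauge_nonneg[OF \<Gamma>] real_of_ereal_pos le_max_iff_disj)
  have scaled: "\<Gamma> (c *\<^sub>R b) \<le> ereal (\<bar>c\<bar> * m b)" if "b \<in> B" for b c
  proof (cases c "0::real" rule: linorder_cases)
    case less
    have "\<Gamma> (c *\<^sub>R b) = \<Gamma> ((- c) *\<^sub>R (- b))" by simp
    also have "\<dots> = ereal (- c) * \<Gamma> (- b)"
      using less by (intro gauge_scaleR[OF \<Gamma>]) simp
    also have "\<dots> \<le> ereal (- c) * ereal (m b)"
      using m[OF that] less by (intro ereal_mult_left_mono) auto
    finally show ?thesis using less by simp
  next
    case equal
    then show ?thesis by (simp add: gauge_zero[OF \<Gamma>])
  next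
    case greater
    then have "\<Gamma> (c *\<^sub>R b) = ereal c * \<Gamma> b"
      by (intro gauge_scaleR[OF \<Gamma>]) simp
    also have "\<dots> \<le> ereal c * ereal (m b)"
      using m[OF that] greater by (intro ereal_mult_left_mono) auto
    finally show ?thesis using greater by simp
  qed
  show ?thesis
  proof (rule that[of "\<Sum>b\<in>B. m b"])
    show "0 \<le> (\<Sum>b\<in>B. m b)" by (simp add: m0 sum_nonneg)
    fix v assume "v \<in> V"
    then have "v = (\<Sum>b\<in>B. (v \<bullet> b) *\<^sub>R b)"
      using orthonormal_basis_expand[OF B(2,3) _ finB, of v] B(5) by (simp add: inner_commute)
    then have "\<Gamma> v = \<Gamma> (\<Sum>b\<in>B. (v \<bullet> b) *\<^sub>R b)"
      by simp
    also have "\<dots> \<le> (\<Sum>b\<in>B. \<Gamma> ((v \<bullet> b) *\<^sub>R b))"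
      by (rule gauge_sum[OF \<Gamma> finB])
    also have "\<dots> \<le> (\<Sum>b\<in>B. ereal (norm v * m b))"
    proof (rule sum_mono)
      fix b assume b: "b \<in> B"
      have "\<bar>v \<bullet> b\<bar> \<le> norm v"
        using Cauchy_Schwarz_ineq2[of v b] B(3)[OF b] by simp
      then have "\<bar>v \<bullet> b\<bar> * m b \<le> norm v * m b"
        using m0 by (rule mult_right_mono)
      then show "\<Gamma> ((v \<bullet> b) *\<^sub>R b) \<le> ereal (norm v * m b)"
        using scaled[OF b, of "v \<bullet> b"] by (meson ereal_less_eq(3) order_trans)
    qed
    also have "\<dots> = ereal ((\<Sum>b\<in>B. m b) * norm v)"
      by (simp add: sum_distrib_left mult.commute)
    finally show "\<Gamma> v \<le> ereal ((\<Sum>b\<in>B. m b) * norm v)" .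
  qed
qed

lemma norm_le_coercive_gauge:
  assumes \<Gamma>: "is_gauge \<Gamma>" and V: "subspace V" and "coercive_on V \<Gamma>"
  obtains K where "0 < K" "\<And>v. v \<in> V \<Longrightarrow> ereal (norm v) \<le> ereal K * \<Gamma> v"
proof -
  have "\<forall>\<^sub>F v in inf at_infinity (principal V). 1 < \<Gamma> v"
    using assms(3) unfolding coercive_on_def by (auto simp: order_tendsto_iff)
  then obtain b where b: "\<And>v. b \<le> norm v \<Longrightarrow> v \<in> V \<Longrightarrow> 1 < \<Gamma> v"
    by (auto simp: eventually_inf_principal eventually_at_infinity)
  define R where "R = max b 1"
  have R: "0 < R" "b \<le> R" by (auto simp: R_def)
  show ?thesis
  proof (rule that[OF R(1)])
    fix v assume v: "v \<in> V"
    show "ereal (norm v) \<le> ereal R * \<Gamma> v"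
    proof (cases "v = 0")
      case True
      then show ?thesis by (simp add: gauge_zero[OF \<Gamma>])
    next
      case False
      \<comment> \<open>Rescale \<open>v\<close> to norm \<open>R\<close>, where coercivity makes the gauge exceed one.\<close>
      have "1 < \<Gamma> ((R / norm v) *\<^sub>R v)"
        using False R v V by (intro b) (auto simp: subspace_scale)
      also have "\<dots> = ereal (R / norm v) * \<Gamma> v"
        using False R by (intro gauge_scaleR[OF \<Gamma>]) simp
      finally have "1 \<le> ereal (R / norm v) * \<Gamma> v" by simp
      then have "ereal (norm v) * 1 \<le> ereal (norm v) * (ereal (R / norm v) * \<Gamma> v)"
        by (intro ereal_mult_left_mono) auto
      also have "\<dots> = ereal R * \<Gamma> v"
        using False by (simp flip: mult.assoc)
      finally show ?thesis by simp
    qed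
  qed
qed

text \<open>The unit ball of the source gauge in \<open>V1\<close> is bounded and the target gauge is bounded on bounded
  sets, so the operator bound is a real number; homogeneity then turns it into an inequality on all
  of \<open>V1\<close>. Where \<open>G1\<close> vanishes, the vector itself is zero.\<close>

lemma op_bound_finite:
  fixes A :: "'a::euclidean_space \<Rightarrow> 'b::euclidean_space"
  assumes G1: "is_gauge G1" and G2: "is_gauge G2" and V1: "subspace V1" and V2: "subspace V2"
    and fin1: "finite_on V1 G1" and fin2: "finite_on V2 G2"
    and K: "0 < K" "\<And>v. v \<in> V1 \<Longrightarrow> ereal (norm v) \<le> ereal K * G1 v"
    and A: "linear A" "\<And>v. v \<in> V1 \<Longrightarrow> A v \<in> V2"
  obtains b where "0 \<le> b" "op_bound V1 G1 G2 A = ereal b"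
    "\<And>v. v \<in> V1 \<Longrightarrow> G2 (A v) \<le> ereal b * G1 v"
proof -
  obtain M where M: "0 \<le> M" "\<And>v. v \<in> V2 \<Longrightarrow> G2 v \<le> ereal (M * norm v)"
    using finite_gauge_le_norm[OF G2 V2 fin2] by metis
  obtain N where N: "0 < N" "\<And>v. norm (A v) \<le> N * norm v"
    using linear_bounded_pos[OF A(1)] by metis
  have "G2 (A v) \<le> ereal (M * N * K)" if v: "v \<in> V1" "G1 v \<le> 1" for v
  proof -
    obtain r where r: "0 \<le> r" "G1 v = ereal r"
      using finite_on_realE[OF G1 fin1 v(1)] .
    have "norm v \<le> K * r" "r \<le> 1"
      using K(2)[OF v(1)] r v(2) by simp_all
    then have "norm v \<le> K"
      using K(1) mult_left_mono[of r 1 K] by linarith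
    then have "norm (A v) \<le> N * K"
      using N(2)[of v] mult_left_mono[of "norm v" K N] N(1) by linarith
    then have "M * norm (A v) \<le> M * N * K"
      using M(1) by (simp add: mult_left_mono mult.assoc)
    then show ?thesis
      using M(2)[OF A(2)[OF v(1)]] by (meson ereal_less_eq(3) order_trans)
  qed
  then have "op_bound V1 G1 G2 A \<le> ereal (M * N * K)"
    unfolding op_bound_def by (auto intro: SUP_least)
  moreover have "0 \<le> op_bound V1 G1 G2 A"
    unfolding op_bound_def
    using V1 by (intro SUP_upper2[of 0]) (auto simp: subspace_0 gauge_zero[OF G1] gauge_nonneg[OF G2])
  ultimately obtain b where b: "0 \<le> b" "op_bound V1 G1 G2 A = ereal b"
    by (cases "op_bound V1 G1 G2 A") auto
  show ?thesis
  proof (rule that[OF b])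
    fix v assume v: "v \<in> V1"
    obtain r where r: "0 \<le> r" "G1 v = ereal r"
      using finite_on_realE[OF G1 fin1 v] .
    show "G2 (A v) \<le> ereal b * G1 v"
    proof (cases "r = 0")
      case True
      then have "v = 0" using K(2)[OF v] r by simp
      then show ?thesis
        by (simp add: gauge_zero[OF G1] gauge_zero[OF G2] linear_0[OF A(1)])
    next
      case False
      then have "0 < r" using r by simp
      then have "G1 ((1 / r) *\<^sub>R v) \<le> 1"
        using r by (simp add: gauge_scaleR[OF G1])
      then have "G2 (A ((1 / r) *\<^sub>R v)) \<le> ereal b"
        using v V1 unfolding b(2)[symmetric] op_bound_def
        by (intro SUP_upper) (auto simp: subspace_scale)
      then have "ereal r * (ereal (1 / r) * G2 (A v)) \<le> ereal r * ereal b"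
        using \<open>0 < r\<close> by (intro ereal_mult_left_mono) (auto simp: linear_scale[OF A(1)] gauge_scaleR[OF G2])
      moreover have "ereal r * (ereal (1 / r) * G2 (A v)) = G2 (A v)"
        using \<open>0 < r\<close> by (simp flip: mult.assoc)
      ultimately show ?thesis
        using r by (simp add: mult.commute)
    qed
  qed
qed

section \<open>Orthogonal projections\<close>

lemma proj_eqI:
  fixes V :: "'a::euclidean_space set"
  assumes "subspace V" "p \<in> V" "\<And>w. w \<in> V \<Longrightarrow> (v - p) \<bullet> w = 0"
  shows "closest_point V v = p"
proof (rule closest_point_unique[symmetric])
  show "\<forall>z\<in>V. dist v p \<le> dist v z"
  proof
    fix z assume "z \<in> V"
    then have "(v - p) \<bullet> (p - z) = 0"
      using assms by (simp add: subspace_diff)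
    then have "(norm (v - z))\<^sup>2 = (norm (v - p))\<^sup>2 + (norm (p - z))\<^sup>2"
      using norm_add_Pythagorean[of "v - p" "p - z"] by (simp add: orthogonal_def)
    then have "(norm (v - p))\<^sup>2 \<le> (norm (v - z))\<^sup>2" by simp
    then show "dist v p \<le> dist v z"
      unfolding dist_norm by (rule power2_le_imp_le) simp
  qed
qed (use assms in \<open>auto intro: subspace_imp_convex closed_subspace\<close>)

lemma proj_in: "subspace V \<Longrightarrow> closest_point V (v::'a::euclidean_space) \<in> V"
  by (rule closest_point_in_set) (auto intro: closed_subspace subspace_0)

lemma proj_orthogonal:
  fixes V :: "'a::euclidean_space set"
  assumes "subspace V" "w \<in> V"
  shows "(v - closest_point V v) \<bullet> w = 0"
proof -
  obtain y z where yz: "y \<in> span V" "\<And>w. w \<in> span V \<Longrightarrow> orthogonal z w" "v = y + z"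
    using orthogonal_subspace_decomp_exists[of V v] by metis
  moreover have "span V = V" using assms(1) by (simp add: span_eq_iff)
  ultimately have "closest_point V v = y"
    using assms by (intro proj_eqI) (auto simp: orthogonal_def)
  then show ?thesis using yz assms by (auto simp: orthogonal_def span_base)
qed

lemma linear_proj:
  fixes V :: "'a::euclidean_space set"
  assumes "subspace V"
  shows "linear (closest_point V)"
proof (rule linearI)
  fix v w :: 'a and a :: real
  show "closest_point V (v + w) = closest_point V v + closest_point V w"
  proof (rule proj_eqI[OF assms])
    fix z assume "z \<in> V"
    then show "(v + w - (closest_point V v + closest_point V w)) \<bullet> z = 0"
      using proj_orthogonal[OF assms, of z v] proj_orthogonal[OF assms, of z w]
      by (simp add: inner_diff_left inner_add_left)
  qed (simp add: assms proj_in subspace_add)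
  show "closest_point V (a *\<^sub>R v) = a *\<^sub>R closest_point V v"
  proof (rule proj_eqI[OF assms])
    fix z assume "z \<in> V"
    then show "(a *\<^sub>R v - a *\<^sub>R closest_point V v) \<bullet> z = 0"
      using proj_orthogonal[OF assms, of z v] by (simp flip: scaleR_diff_right)
  qed (simp add: assms proj_in subspace_scale)
qed

lemma proj_self_adjoint:
  fixes V :: "'a::euclidean_space set"
  assumes "subspace V"
  shows "closest_point V v \<bullet> w = v \<bullet> closest_point V w"
proof -
  have "(v - closest_point V v) \<bullet> closest_point V w = 0"
    "(w - closest_point V w) \<bullet> closest_point V v = 0"
    by (simp_all add: assms proj_in proj_orthogonal)
  then show ?thesis
    by (simp add: inner_diff_left inner_diff_right inner_commute)
qed

lemma orthogonal_comp_iff: "v \<in> V\<^sup>\<bottom> \<longleftrightarrow> (\<forall>w\<in>V. v \<bullet> w = 0)"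
  by (auto simp: orthogonal_comp_def orthogonal_def inner_commute)

lemma proj_add_proj_orthogonal_comp:
  fixes V :: "'a::euclidean_space set"
  assumes "subspace V"
  shows "closest_point V v + closest_point (V\<^sup>\<bottom>) v = v"
proof -
  have "closest_point (V\<^sup>\<bottom>) v = v - closest_point V v"
    using proj_orthogonal[OF assms] proj_in[OF assms]
    by (intro proj_eqI subspace_orthogonal_comp) (auto simp: orthogonal_comp_iff inner_commute)
  then show ?thesis by simp
qed

section \<open>Subdifferentials and the chain rule\<close>

lemma subdifferentialD: "g \<in> subdifferential J x \<Longrightarrow> J x + g \<bullet> (y - x) \<le> J y"
  by (simp add: subdifferential_def)

lemma convex_subdifferential: "convex (subdifferential J x)"
proof -
  have "subdifferential J x = (\<Inter>y. {g. (y - x) \<bullet> g \<le> J y - J x})"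
    by (auto simp: subdifferential_def inner_commute algebra_simps)
  then show ?thesis by (auto intro: convex_INT convex_halfspace_le)
qed

lemma closed_subdifferential: "closed (subdifferential J x)"
proof -
  have "subdifferential J x = (\<Inter>y. {g. (y - x) \<bullet> g \<le> J y - J x})"
    by (auto simp: subdifferential_def inner_commute algebra_simps)
  then show ?thesis by (auto intro: closed_INT closed_halfspace_le)
qed

lemma continuous_convex_on_UNIV:
  "convex_on UNIV J \<Longrightarrow> continuous_on UNIV (J :: 'a::euclidean_space \<Rightarrow> real)"
  by (rule convex_on_continuous) auto

text \<open>Moving a unit step from \<open>x\<close> in the direction of a subgradient raises \<open>J\<close> by at least the norm of
  the subgradient, while \<open>J\<close> is bounded on the unit ball around \<open>x\<close>.\<close>

lemma subdifferential_bounded: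
  fixes J :: "'a::euclidean_space \<Rightarrow> real"
  assumes "convex_on UNIV J"
  obtains K where "0 < K" "\<And>g. g \<in> subdifferential J x \<Longrightarrow> norm g \<le> K"
proof -
  have "compact (J ` cball x 1)"
    using continuous_convex_on_UNIV[OF assms]
    by (intro compact_continuous_image) (auto intro: continuous_on_subset)
  then obtain M where M: "\<And>y. y \<in> cball x 1 \<Longrightarrow> \<bar>J y\<bar> \<le> M"
    by (force dest!: compact_imp_bounded simp: bounded_iff)
  have M0: "0 \<le> M" using M[of x] by simp
  show ?thesis
  proof (rule that[of "2 * M + 1"])
    show "0 < 2 * M + 1" using M0 by simp
    fix g assume g: "g \<in> subdifferential J x"
    have "J x + g \<bullet> sgn g \<le> J (x + sgn g)"
      using subdifferentialD[OF g, of "x + sgn g"] by simp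
    moreover have "g \<bullet> sgn g = norm g"
      by (cases "g = 0") (simp_all add: sgn_div_norm dot_square_norm power2_eq_square)
    moreover have "x + sgn g \<in> cball x 1"
      by (simp add: dist_norm norm_sgn)
    then have "\<bar>J (x + sgn g)\<bar> \<le> M" by (rule M)
    moreover have "\<bar>J x\<bar> \<le> M" using M[of x] by simp
    ultimately show "norm g \<le> 2 * M + 1" by linarith
  qed
qed

lemma subdifferential_closed_graph:
  fixes J :: "'a::euclidean_space \<Rightarrow> real"
  assumes "convex_on UNIV J" "\<And>n. g n \<in> subdifferential J (z n)" "z \<longlonglongrightarrow> x" "g \<longlonglongrightarrow> l"
  shows "l \<in> subdifferential J x"
  unfolding subdifferential_def
proof (clarify)
  fix y
  have "isCont J x"
    using continuous_convex_on_UNIV[OF assms(1)] by (simp add: continuous_on_eq_continuous_at)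
  then have "(\<lambda>n. J (z n) + g n \<bullet> (y - z n)) \<longlonglongrightarrow> J x + l \<bullet> (y - x)"
    using assms by (intro tendsto_intros isCont_tendsto_compose[of x J])
  then show "J x + l \<bullet> (y - x) \<le> J y"
    by (rule LIMSEQ_le_const2) (auto intro: subdifferentialD[OF assms(2)])
qed

lemma inner_bounded_above_imp_zero:
  fixes z :: "'a::real_inner"
  assumes "\<And>y. z \<bullet> y \<le> c"
  shows "z = 0"
proof (rule ccontr)
  assume "z \<noteq> 0"
  then have "z \<bullet> (((\<bar>c\<bar> + 1) / (z \<bullet> z)) *\<^sub>R z) = \<bar>c\<bar> + 1" by simp
  then show False using assms[of "((\<bar>c\<bar> + 1) / (z \<bullet> z)) *\<^sub>R z"] by linarith
qed

text \<open>A Hahn--Banach extension: a linear minorant of \<open>J0\<close> along the affine subspace \<open>u + range A\<close>, exact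
  at \<open>u\<close>, is induced by a subgradient of \<open>J0\<close> at \<open>u\<close>. The graph of the minorant is disjoint from the
  strict epigraph of \<open>J0\<close>, and a hyperplane separating the two is not vertical because the
  epigraph lies over the whole space.\<close>

lemma subgradient_extension:
  fixes J0 :: "'b::euclidean_space \<Rightarrow> real" and A :: "'a::euclidean_space \<Rightarrow> 'b"
  assumes J0: "convex_on UNIV J0" and A: "linear A"
    and minorant: "\<And>y. J0 u + g \<bullet> y \<le> J0 (u + A y)"
  obtains h where "h \<in> subdifferential J0 u" "\<And>y. h \<bullet> A y = g \<bullet> y"
proof -
  define E where "E = {(w, t). J0 w < t}"
  define L where "L = range (\<lambda>y. (u + A y, J0 u + g \<bullet> y))"
  have "convex E"
  proof (rule convexI)
    fix p q :: "'b \<times> real" and a b :: real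
    assume pq: "p \<in> E" "q \<in> E" and ab: "0 \<le> a" "0 \<le> b" "a + b = 1"
    have "J0 (a *\<^sub>R fst p + b *\<^sub>R fst q) \<le> a * J0 (fst p) + b * J0 (fst q)"
      using J0 ab by (auto simp: convex_on_def)
    also have "\<dots> < a * snd p + b * snd q"
    proof (cases "a = 0")
      case True
      then show ?thesis using pq ab by (auto simp: E_def)
    next
      case False
      then have "a * J0 (fst p) < a * snd p"
        using pq ab by (auto simp: E_def)
      moreover have "b * J0 (fst q) \<le> b * snd q"
        using pq ab by (intro mult_left_mono) (auto simp: E_def)
      ultimately show ?thesis by linarith
    qed
    finally show "a *\<^sub>R p + b *\<^sub>R q \<in> E"
      by (simp add: E_def case_prod_beta)
  qed
  moreover have "convex L"
  proof -
    have "linear (\<lambda>y. (A y, g \<bullet> y))"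
      by (rule linearI) (simp_all add: linear_add[OF A] linear_scale[OF A] inner_add_right)
    then have "convex (range (\<lambda>y. (A y, g \<bullet> y)))"
      by (intro convex_linear_image) auto
    moreover have "L = (+) (u, J0 u) ` range (\<lambda>y. (A y, g \<bullet> y))"
      by (auto simp: L_def image_image)
    ultimately show ?thesis by (simp add: convex_translation)
  qed
  moreover have "L \<noteq> {}" by (auto simp: L_def)
  moreover have "(u, J0 u + 1) \<in> E" by (simp add: E_def)
  moreover have "L \<inter> E = {}" using minorant by (auto simp: L_def E_def not_less[symmetric])
  ultimately obtain n b where n: "n \<noteq> 0" "\<And>q. q \<in> L \<Longrightarrow> n \<bullet> q \<le> b" "\<And>q. q \<in> E \<Longrightarrow> b \<le> n \<bullet> q"
    using separating_hyperplane_sets[of L E] by blast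
  obtain p \<alpha> where p: "n = (p, \<alpha>)" by (cases n)
  have L: "p \<bullet> (u + A y) + \<alpha> * (J0 u + g \<bullet> y) \<le> b" for y
    using n(2)[of "(u + A y, J0 u + g \<bullet> y)"] by (auto simp: L_def p)
  have E: "b \<le> p \<bullet> w + \<alpha> * t" if "J0 w < t" for w t
    using n(3)[of "(w, t)"] that by (simp add: E_def p)
  have "0 < \<alpha>"
  proof (rule ccontr)
    assume "\<not> 0 < \<alpha>"
    show False
    proof (cases "\<alpha> = 0")
      case True
      then have "(- p) \<bullet> w \<le> - b" for w
        using E[of w "J0 w + 1"] by simp
      then have "- p = 0" by (rule inner_bounded_above_imp_zero)
      then show False using True n(1) p by (simp add: zero_prod_def)
    next
      case False
      then have "\<alpha> < 0" using \<open>\<not> 0 < \<alpha>\<close> by simp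
      define t where "t = max (J0 0 + 1) ((b - 1) / \<alpha>)"
      have "b \<le> \<alpha> * t" using E[of 0 t] by (simp add: t_def)
      also have "\<dots> \<le> \<alpha> * ((b - 1) / \<alpha>)"
        using \<open>\<alpha> < 0\<close> by (intro mult_left_mono_neg) (auto simp: t_def)
      also have "\<dots> = b - 1" using \<open>\<alpha> < 0\<close> by simp
      finally show False by simp
    qed
  qed
  have "(adjoint A p + \<alpha> *\<^sub>R g) \<bullet> y \<le> b - p \<bullet> u - \<alpha> * J0 u" for y
    using L[of y] by (simp add: inner_add_left inner_add_right adjoint_clauses[OF A] algebra_simps)
  then have "adjoint A p + \<alpha> *\<^sub>R g = 0" by (rule inner_bounded_above_imp_zero)
  then have "(adjoint A p + \<alpha> *\<^sub>R g) \<bullet> y = 0" for y by simp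
  then have pA: "p \<bullet> A y = - \<alpha> * (g \<bullet> y)" for y
    by (simp add: inner_add_left adjoint_clauses[OF A] add_eq_0_iff2)
  show ?thesis
  proof (rule that)
    show "(- (1 / \<alpha>)) *\<^sub>R p \<in> subdifferential J0 u"
      unfolding subdifferential_def
    proof clarify
      fix w
      have "b \<le> p \<bullet> w + \<alpha> * J0 w"
      proof (rule field_le_epsilon)
        fix e :: real assume "0 < e"
        then have "b \<le> p \<bullet> w + \<alpha> * (J0 w + e / \<alpha>)"
          using \<open>0 < \<alpha>\<close> by (intro E) simp
        then show "b \<le> p \<bullet> w + \<alpha> * J0 w + e"
          using \<open>0 < \<alpha>\<close> by (simp add: distrib_left)
      qed
      then have "p \<bullet> u + \<alpha> * J0 u \<le> p \<bullet> w + \<alpha> * J0 w"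
        using L[of 0] by (simp add: linear_0[OF A])
      then have "\<alpha> * J0 u - p \<bullet> (w - u) \<le> \<alpha> * J0 w"
        by (simp add: inner_diff_right)
      then have "(\<alpha> * J0 u - p \<bullet> (w - u)) / \<alpha> \<le> J0 w"
        using \<open>0 < \<alpha>\<close> by (simp add: pos_divide_le_eq mult.commute)
      then show "J0 u + (- (1 / \<alpha>)) *\<^sub>R p \<bullet> (w - u) \<le> J0 w"
        using \<open>0 < \<alpha>\<close> by (simp add: diff_divide_distrib)
    qed
    show "(- (1 / \<alpha>)) *\<^sub>R p \<bullet> A y = g \<bullet> y" for y
      using \<open>0 < \<alpha>\<close> by (simp add: pA)
  qed
qed

text \<open>This is the extension of the zero minorant along the single point \<open>x\<close>.\<close>

lemma subdifferential_nonempty: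
  fixes J :: "'a::euclidean_space \<Rightarrow> real"
  assumes "convex_on UNIV J"
  shows "subdifferential J x \<noteq> {}"
  using subgradient_extension[OF assms linear_zero, of x "0 :: 'a"] by auto

lemma convex_on_comp_linear:
  fixes A :: "'a::real_vector \<Rightarrow> 'b::real_vector"
  assumes "convex_on UNIV J0" "linear A"
  shows "convex_on UNIV (\<lambda>y. J0 (A y))"
  using assms by (simp add: convex_on_def linear_add linear_scale)

text \<open>A subgradient \<open>g\<close> of the composition is a linear minorant of \<open>J0\<close> along the range of the adjoint.
  The subgradient \<open>h\<close> of \<open>J0\<close> that extends it satisfies \<open>D h = g\<close>.\<close>

lemma subdifferential_comp_adjoint:
  fixes D :: "'b::euclidean_space \<Rightarrow> 'a::euclidean_space"
  assumes J0: "convex_on UNIV J0" and D: "linear D"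
  shows "subdifferential (\<lambda>y. J0 (adjoint D y)) y = D ` subdifferential J0 (adjoint D y)"
proof
  note D' = adjoint_linear[OF D]
  show "subdifferential (\<lambda>y. J0 (adjoint D y)) y \<subseteq> D ` subdifferential J0 (adjoint D y)"
  proof
    fix g assume g: "g \<in> subdifferential (\<lambda>y. J0 (adjoint D y)) y"
    have "J0 (adjoint D y) + g \<bullet> z \<le> J0 (adjoint D y + adjoint D z)" for z
      using subdifferentialD[OF g, of "y + z"] by (simp add: linear_add[OF D'])
    then obtain h where h: "h \<in> subdifferential J0 (adjoint D y)" "\<And>z. h \<bullet> adjoint D z = g \<bullet> z"
      using subgradient_extension[OF J0 D'] by metis
    then have "D h \<bullet> z = g \<bullet> z" for z
      by (simp add: adjoint_clauses[OF D])
    then have "D h = g" by (metis vector_eq_rdot)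
    then show "g \<in> D ` subdifferential J0 (adjoint D y)" using h by auto
  qed
  show "D ` subdifferential J0 (adjoint D y) \<subseteq> subdifferential (\<lambda>y. J0 (adjoint D y)) y"
    by (auto simp: subdifferential_def adjoint_clauses(1)[OF D, symmetric] linear_diff[OF D'])
qed

section \<open>Model subspaces\<close>

lemma model_vector_in_affine_hull:
  assumes "convex_on UNIV J"
  shows "model_vector J x \<in> affine hull subdifferential J x"
  unfolding model_vector_def
  using subdifferential_nonempty[OF assms, of x]
  by (intro closest_point_in_set closed_affine_hull) auto

lemma subspace_model_S:
  assumes "convex_on UNIV J"
  shows "subspace (model_S J x)"
  unfolding model_S_def
  by (intro affine_diffs_subspace_subtract affine_affine_hull model_vector_in_affine_hull assms)

lemma diff_in_model_S:
  assumes "convex_on UNIV J" "a \<in> affine hull subdifferential J x" "b \<in> affine hull subdifferential J x"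
  shows "a - b \<in> model_S J x"
proof -
  have "(a - model_vector J x) - (b - model_vector J x) \<in> model_S J x"
    unfolding model_S_def
    by (intro subspace_diff subspace_model_S[OF assms(1), unfolded model_S_def] imageI assms)
  then show ?thesis by simp
qed

lemma affine_hull_subdifferential_eq:
  assumes "convex_on UNIV J" "a \<in> affine hull subdifferential J x"
  shows "affine hull subdifferential J x = (+) a ` model_S J x"
proof
  show "affine hull subdifferential J x \<subseteq> (+) a ` model_S J x"
    using diff_in_model_S[OF assms(1) _ assms(2)] by (force intro!: image_eqI[where x = "_ - a"])
  have "a + (b - model_vector J x) \<in> affine hull subdifferential J x"
    if "b \<in> affine hull subdifferential J x" for b
    using mem_affine_3_minus[OF affine_affine_hull assms(2) that
        model_vector_in_affine_hull[OF assms(1)], of 1] by simp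
  then show "(+) a ` model_S J x \<subseteq> affine hull subdifferential J x"
    by (auto simp: model_S_def)
qed

lemma subspace_model_T: "subspace (model_T J x)"
  by (simp add: model_T_def subspace_orthogonal_comp)

lemma in_model_T_iff: "v \<in> model_T J x \<longleftrightarrow> (\<forall>s\<in>model_S J x. v \<bullet> s = 0)"
  by (simp add: model_T_def orthogonal_comp_iff)

text \<open>The point of an affine set closest to the origin is orthogonal to the directions of the set;
  reflecting the set in that point turns the variational inequality into an equation.\<close>

lemma model_vector_in_model_T:
  assumes "convex_on UNIV J"
  shows "model_vector J x \<in> model_T J x"
  unfolding in_model_T_iff
proof
  let ?A = "affine hull subdifferential J x" and ?e = "model_vector J x"
  fix s assume s: "s \<in> model_S J x"
  have le: "- (?e \<bullet> t) \<le> 0" if "t \<in> model_S J x" for t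
  proof -
    have "?e + t \<in> ?A"
      using that affine_hull_subdifferential_eq[OF assms model_vector_in_affine_hull[OF assms]] by auto
    then have "(0 - ?e) \<bullet> (?e + t - ?e) \<le> 0"
      unfolding model_vector_def
      by (intro closest_point_dot) (auto intro: affine_imp_convex closed_affine_hull affine_affine_hull)
    then show ?thesis by simp
  qed
  have "- s \<in> model_S J x" using s subspace_model_S[OF assms] by (rule subspace_neg[rotated])
  then show "?e \<bullet> s = 0" using le[of s] le[of "- s"] s by simp
qed

text \<open>All points of the affine hull have the same component in the model subspace, so differences of
  model vectors can be computed from arbitrary representatives.\<close>

lemma proj_model_T_eq_model_vector:
  assumes "convex_on UNIV J" "a \<in> affine hull subdifferential J x"
  shows "closest_point (model_T J x) a = model_vector J x"
proof (rule proj_eqI[OF subspace_model_T model_vector_in_model_T[OF assms(1)]])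
  fix w assume "w \<in> model_T J x"
  moreover have "a - model_vector J x \<in> model_S J x"
    using assms by (intro diff_in_model_S model_vector_in_affine_hull)
  ultimately show "(a - model_vector J x) \<bullet> w = 0"
    unfolding in_model_T_iff by (metis inner_commute)
qed

text \<open>A linear map sends affine hulls to affine hulls, and \<open>model_S\<close> is the direction space of the affine
  hull; the two model vectors, in contrast, need not correspond under \<open>D\<close>.\<close>

lemma model_S_comp_adjoint:
  fixes D :: "'b::euclidean_space \<Rightarrow> 'a::euclidean_space"
  assumes J0: "convex_on UNIV J0" and D: "linear D"
  shows "model_S (\<lambda>y. J0 (adjoint D y)) y = D ` model_S J0 (adjoint D y)"
proof -
  let ?J = "\<lambda>y. J0 (adjoint D y)"
  have J: "convex_on UNIV ?J" by (rule convex_on_comp_linear[OF J0 adjoint_linear[OF D]])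
  have aff: "affine hull subdifferential ?J y = D ` (affine hull subdifferential J0 (adjoint D y))"
    using D by (simp add: subdifferential_comp_adjoint[OF J0 D] affine_hull_linear_image linear_conv_bounded_linear)
  obtain a where a: "a \<in> affine hull subdifferential J0 (adjoint D y)"
    using model_vector_in_affine_hull[OF J0] by blast
  have "(+) (D a) ` model_S ?J y = D ` (+) a ` model_S J0 (adjoint D y)"
    using affine_hull_subdifferential_eq[OF J0 a] affine_hull_subdifferential_eq[OF J, of "D a" y] a
    by (simp add: aff)
  also have "\<dots> = (+) (D a) ` D ` model_S J0 (adjoint D y)"
    by (simp add: image_image linear_add[OF D])
  finally show ?thesis by (simp add: inj_image_eq_iff)
qed

lemma model_T_comp_adjoint:
  fixes D :: "'b::euclidean_space \<Rightarrow> 'a::euclidean_space"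
  assumes "convex_on UNIV J0" "linear D"
  shows "model_T (\<lambda>y. J0 (adjoint D y)) y = adjoint D -` model_T J0 (adjoint D y)"
  by (auto simp: in_model_T_iff model_S_comp_adjoint[OF assms] adjoint_clauses[OF assms(2)])

section \<open>Regularity along a linear map\<close>

lemma C2_on_comp_linear:
  fixes A :: "'a::euclidean_space \<Rightarrow> 'b::euclidean_space" and g :: "'b \<Rightarrow> 'c::real_normed_vector"
  assumes A: "linear A" and g: "C2_on U g"
  shows "C2_on (A -` U) (\<lambda>z. g (A z))"
proof -
  obtain g' g'' where g':
      "\<And>z. z \<in> U \<Longrightarrow> (g has_derivative blinfun_apply (g' z)) (at z)"
      "\<And>z. z \<in> U \<Longrightarrow> (g' has_derivative blinfun_apply (g'' z)) (at z)"
      "continuous_on U g''"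
    using g unfolding C2_on_def by metis
  have bl: "bounded_linear A" using A by (simp add: linear_conv_bounded_linear)
  define AL where "AL = Blinfun A"
  have AL: "blinfun_apply AL = A" by (simp add: AL_def bounded_linear_Blinfun_apply[OF bl])
  \<comment> \<open>Precomposition with \<open>A\<close>, as a bounded linear map between spaces of derivatives.\<close>
  have blR: "bounded_linear (\<lambda>\<phi> :: 'b \<Rightarrow>\<^sub>L 'c. \<phi> o\<^sub>L AL)"
    by (rule bounded_bilinear.bounded_linear_left[OF bounded_bilinear_blinfun_compose])
  define R :: "('b \<Rightarrow>\<^sub>L 'c) \<Rightarrow>\<^sub>L ('a \<Rightarrow>\<^sub>L 'c)" where "R = Blinfun (\<lambda>\<phi>. \<phi> o\<^sub>L AL)"
  have R: "blinfun_apply R = (\<lambda>\<phi>. \<phi> o\<^sub>L AL)" by (simp add: R_def bounded_linear_Blinfun_apply[OF blR])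
  have dA: "(A has_derivative A) (at z)" for z
    by (rule bounded_linear_imp_has_derivative[OF bl])
  show ?thesis
    unfolding C2_on_def
  proof (intro exI conjI ballI)
    fix z assume z: "z \<in> A -` U"
    show "((\<lambda>z. g (A z)) has_derivative blinfun_apply (g' (A z) o\<^sub>L AL)) (at z)"
      using has_derivative_compose[OF dA g'(1), of z] z by (simp add: AL blinfun_compose.rep_eq o_def)
    have "((\<lambda>z. g' (A z)) has_derivative (\<lambda>h. g'' (A z) (A h))) (at z)"
      using has_derivative_compose[OF dA g'(2), of z] z by simp
    then show "((\<lambda>z. g' (A z) o\<^sub>L AL) has_derivative blinfun_apply (R o\<^sub>L (g'' (A z) o\<^sub>L AL))) (at z)"
      using bounded_linear.has_derivative[OF blR] by (simp add: R AL blinfun_compose.rep_eq o_def)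
  next
    have "continuous_on (A -` U) (\<lambda>z. g'' (A z))"
      using g'(3) linear_continuous_on[OF bl] by (rule continuous_on_compose2) auto
    then show "continuous_on (A -` U) (\<lambda>z. R o\<^sub>L (g'' (A z) o\<^sub>L AL))"
      by (intro bounded_bilinear.continuous_on[OF bounded_bilinear_blinfun_compose] continuous_on_const)
  qed
qed

lemma C2_manifold_around_subspace:
  fixes T :: "'a::euclidean_space set"
  assumes "subspace T"
  shows "C2_manifold_around T x"
proof -
  have "C2_on UNIV (\<lambda>z :: 'a. z)"
    unfolding C2_on_def
    by (rule exI[where x = "\<lambda>_. id_blinfun"], rule exI[where x = "\<lambda>_. 0"])
      (auto simp: id_blinfun.rep_eq zero_blinfun.rep_eq)
  moreover have "homeomorphism UNIV UNIV (\<lambda>z :: 'a. z) (\<lambda>z. z)"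
    by (simp add: homeomorphism_def)
  ultimately show ?thesis
    unfolding C2_manifold_around_def using assms
    by (intro exI[of _ UNIV] exI[of _ T] exI[of _ "\<lambda>z. z"]) auto
qed

text \<open>A curve that stays in \<open>T\<close> is fixed by the projection onto \<open>T\<close>, hence so is its velocity.\<close>

lemma tangent_space_subspace:
  fixes T :: "'a::euclidean_space set"
  assumes T: "subspace T" and x: "x \<in> T"
  shows "tangent_space T x = T"
proof
  show "tangent_space T x \<subseteq> T"
  proof
    fix v assume "v \<in> tangent_space T x"
    then obtain e c where e: "0 < e" and c: "c 0 = x" "\<And>t. t \<in> {-e<..<e} \<Longrightarrow> c t \<in> T"
        "(c has_vector_derivative v) (at (0::real))"
      unfolding tangent_space_def by blast
    have "bounded_linear (closest_point T)"
      using linear_proj[OF T] by (simp add: linear_conv_bounded_linear)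
    then have "((\<lambda>t. closest_point T (c t)) has_vector_derivative closest_point T v) (at 0)"
      using c(3) by (rule bounded_linear.has_vector_derivative)
    then have "(c has_vector_derivative closest_point T v) (at 0)"
      by (rule has_vector_derivative_transform_within_open[where S = "{-e<..<e}"])
        (use e c(2) in \<open>auto intro: closest_point_self\<close>)
    then have "v = closest_point T v"
      using c(3) by (rule vector_derivative_unique_at[rotated])
    then show "v \<in> T" using proj_in[OF T] by metis
  qed
  show "T \<subseteq> tangent_space T x"
  proof
    fix v assume v: "v \<in> T"
    have "((\<lambda>t. x + t *\<^sub>R v) has_vector_derivative v) (at t)" for t
      by (auto intro!: derivative_eq_intros)
    then show "v \<in> tangent_space T x"
      unfolding tangent_space_def using T x v
      by (intro CollectI exI[of _ 1] conjI exI[of _ "\<lambda>t. x + t *\<^sub>R v"])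
        (auto simp: C1_differentiable_on_def subspace_add subspace_scale intro!: exI[of _ "\<lambda>_. v"])
  qed
qed

text \<open>A \<open>C\<^sup>2\<close> extension of \<open>J0\<close> off its model subspace is pulled back along the adjoint. In the
  continuity of the subdifferential, limits of subgradients are subgradients for every finite convex
  function; subgradients approximating a given one are the images under \<open>D\<close> of those for \<open>J0\<close>.\<close>

lemma partly_smooth_comp_adjoint:
  fixes D :: "'b::euclidean_space \<Rightarrow> 'a::euclidean_space"
  assumes D: "linear D" and ps: "partly_smooth J0 (adjoint D x) (model_T J0 (adjoint D x))"
  shows "partly_smooth (\<lambda>y. J0 (adjoint D y)) x (model_T (\<lambda>y. J0 (adjoint D y)) x)"
proof -
  define A where "A = adjoint D"
  define J where "J = (\<lambda>y. J0 (A y))"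
  define T where "T = model_T J x"
  have A: "linear A" unfolding A_def by (rule adjoint_linear[OF D])
  then have contA: "continuous_on UNIV A" by (simp add: linear_continuous_on linear_conv_bounded_linear)
  have J0: "convex_on UNIV J0" and u: "A x \<in> model_T J0 (A x)"
    and C2: "C2_around_rel J0 (A x) (model_T J0 (A x))"
    and cont: "setvalued_continuous_rel (subdifferential J0) (A x) (model_T J0 (A x))"
    using ps by (simp_all add: partly_smooth_def A_def)
  have T: "T = A -` model_T J0 (A x)"
    unfolding T_def J_def A_def by (rule model_T_comp_adjoint[OF J0 D])
  have subd: "subdifferential J y = D ` subdifferential J0 (A y)" for y
    unfolding J_def A_def by (rule subdifferential_comp_adjoint[OF J0 D])
  have J: "convex_on UNIV J"
    unfolding J_def by (rule convex_on_comp_linear[OF J0 A])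
  have x: "x \<in> T" using u T by simp
  have subT: "subspace T" unfolding T_def by (rule subspace_model_T)
  have tendsto_A: "(\<lambda>n. A (z n)) \<longlonglongrightarrow> A x" if "z \<longlonglongrightarrow> x" for z :: "nat \<Rightarrow> 'a"
    using A that unfolding linear_conv_bounded_linear by (rule bounded_linear.tendsto)
  have "C2_around_rel J x T"
  proof -
    obtain U g where g: "open U" "A x \<in> U" "C2_on U g" "\<And>z. z \<in> model_T J0 (A x) \<inter> U \<Longrightarrow> J0 z = g z"
      using C2 unfolding C2_around_rel_def by blast
    have "open (A -` U)" using contA g(1) by (rule open_vimage[rotated])
    moreover have "J z = g (A z)" if "z \<in> T \<inter> A -` U" for z
      using that g(4)[of "A z"] T by (simp add: J_def)
    ultimately show ?thesis
      unfolding C2_around_rel_def using g(2) C2_on_comp_linear[OF A g(3)]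
      by (intro exI[of _ "A -` U"] exI[of _ "\<lambda>z. g (A z)"]) simp
  qed
  moreover have "setvalued_continuous_rel (subdifferential J) x T"
    unfolding setvalued_continuous_rel_def
  proof (intro conjI allI impI ballI)
    fix z y l assume "\<forall>n::nat. z n \<in> T \<and> y n \<in> subdifferential J (z n)" "z \<longlonglongrightarrow> x" "y \<longlonglongrightarrow> l"
    then show "l \<in> subdifferential J x"
      using subdifferential_closed_graph[OF J, where g = y and z = z] by simp
  next
    fix l z assume l: "l \<in> subdifferential J x" and z: "\<forall>n::nat. z n \<in> T" "z \<longlonglongrightarrow> x"
    obtain h where h: "h \<in> subdifferential J0 (A x)" "l = D h"
      using l by (auto simp: subd)
    have "\<forall>n. A (z n) \<in> model_T J0 (A x)" using z(1) T by simp
    then obtain y where y: "y \<longlonglongrightarrow> h" "\<forall>\<^sub>F n in sequentially. y n \<in> subdifferential J0 (A (z n))"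
      using cont[unfolded setvalued_continuous_rel_def, THEN conjunct2, rule_format,
          OF h(1), of "\<lambda>n. A (z n)"] tendsto_A[OF z(2)] by auto
    have "(\<lambda>n. D (y n)) \<longlonglongrightarrow> l"
      unfolding h(2) using D y(1) unfolding linear_conv_bounded_linear by (rule bounded_linear.tendsto)
    moreover have "\<forall>\<^sub>F n in sequentially. D (y n) \<in> subdifferential J (z n)"
      using y(2) by eventually_elim (auto simp: subd)
    ultimately show "\<exists>y. y \<longlonglongrightarrow> l \<and> (\<forall>\<^sub>F n in sequentially. y n \<in> subdifferential J (z n))"
      by blast
  qed
  ultimately have "partly_smooth J x T"
    unfolding partly_smooth_def
    using J x C2_manifold_around_subspace[OF subT] tangent_space_subspace[OF subT x]
    by (simp add: T_def)
  then show ?thesis by (simp add: J_def T_def A_def)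
qed

lemma setvalued_lipschitz_comp_adjoint:
  fixes D :: "'b::euclidean_space \<Rightarrow> 'a::euclidean_space"
  assumes J0: "convex_on UNIV J0" and D: "linear D"
    and lip: "setvalued_lipschitz_around_rel (subdifferential J0) (adjoint D x) M"
  shows "setvalued_lipschitz_around_rel (subdifferential (\<lambda>y. J0 (adjoint D y))) x (adjoint D -` M)"
proof -
  define A where "A = adjoint D"
  have A: "linear A" unfolding A_def by (rule adjoint_linear[OF D])
  obtain \<beta> U where \<beta>: "0 \<le> \<beta>" "open U" "A x \<in> U"
    and incl: "\<forall>z\<in>M \<inter> U. \<forall>z'\<in>M \<inter> U. subdifferential J0 z' \<subseteq>
        {g + h | g h. g \<in> subdifferential J0 z \<and> h \<in> cball 0 (\<beta> * norm (z - z'))}"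
    using lip unfolding setvalued_lipschitz_around_rel_def A_def[symmetric]
    by (elim exE conjE) (rule that)
  obtain a where a: "0 < a" "\<And>v. norm (A v) \<le> a * norm v"
    using linear_bounded_pos[OF A] by metis
  obtain d where d: "0 < d" "\<And>v. norm (D v) \<le> d * norm v"
    using linear_bounded_pos[OF D] by metis
  have subd: "subdifferential (\<lambda>y. J0 (A y)) y = D ` subdifferential J0 (A y)" for y
    unfolding A_def by (rule subdifferential_comp_adjoint[OF J0 D])
  have "setvalued_lipschitz_around_rel (subdifferential (\<lambda>y. J0 (A y))) x (A -` M)"
    unfolding setvalued_lipschitz_around_rel_def
  proof (intro exI[of _ "d * \<beta> * a"] exI[of _ "A -` U"] conjI ballI subsetI)
    show "0 \<le> d * \<beta> * a" using a d \<beta> by simp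
    show "open (A -` U)"
      using A \<beta>(2) by (intro continuous_open_vimage) (auto simp: linear_continuous_at linear_conv_bounded_linear)
    show "x \<in> A -` U" using \<beta> by simp
    fix z z' l assume z: "z \<in> A -` M \<inter> A -` U" "z' \<in> A -` M \<inter> A -` U"
      and l: "l \<in> subdifferential (\<lambda>y. J0 (A y)) z'"
    obtain k where k: "k \<in> subdifferential J0 (A z')" "l = D k"
      using l by (auto simp: subd)
    then obtain g h where gh: "k = g + h" "g \<in> subdifferential J0 (A z)" "norm h \<le> \<beta> * norm (A z - A z')"
      using incl[rule_format, of "A z" "A z'", THEN subsetD, OF _ _ k(1)] z by auto
    have "norm (D h) \<le> d * norm h" by (rule d)
    also have "\<dots> \<le> d * (\<beta> * norm (A z - A z'))" using gh d by simp
    also have "\<dots> \<le> d * (\<beta> * (a * norm (z - z')))"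
      using a(2)[of "z - z'"] d \<beta> by (intro mult_left_mono) (auto simp: linear_diff[OF A])
    finally have "D h \<in> cball 0 (d * \<beta> * a * norm (z - z'))" by (simp add: mult.assoc)
    then show "l \<in> {g + h |g h. g \<in> subdifferential (\<lambda>y. J0 (A y)) z \<and> h \<in> cball 0 (d * \<beta> * a * norm (z - z'))}"
      using gh k by (auto simp: subd linear_add[OF D] simp del: mem_cball)
  qed
  then show ?thesis by (simp add: A_def)
qed

section \<open>Subdifferential gauges\<close>

lemma is_gauge_subdiff_gauge:
  assumes "g \<in> subdifferential J x"
  shows "is_gauge (subdiff_gauge J x g)"
  unfolding is_gauge_def subdiff_gauge_def using assms
  by (intro exI[of _ "(\<lambda>h. h - g) ` subdifferential J x"])
    (auto simp: closed_translation_subtract closed_subdifferential convex_subdifferential)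

text \<open>As \<open>g\<close> is relatively interior, adding to it any small vector of \<open>model_S J x\<close> stays in the
  subdifferential.\<close>

lemma finite_on_subdiff_gauge:
  fixes J :: "'a::euclidean_space \<Rightarrow> real"
  assumes J: "convex_on UNIV J" and g: "g \<in> rel_interior (subdifferential J x)"
  shows "finite_on (model_S J x) (subdiff_gauge J x g)"
proof -
  obtain r where r: "0 < r" "cball g r \<inter> affine hull subdifferential J x \<subseteq> subdifferential J x"
      and gJ: "g \<in> subdifferential J x"
    using g by (auto simp: mem_rel_interior_cball)
  have "cball 0 r \<inter> model_S J x \<subseteq> (\<lambda>h. h - g) ` subdifferential J x"
  proof
    fix s assume s: "s \<in> cball 0 r \<inter> model_S J x"
    then have "g + s \<in> affine hull subdifferential J x"
      using affine_hull_subdifferential_eq[OF J hull_inc[OF gJ]] by auto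
    then have "g + s \<in> subdifferential J x"
      using s r(2) by (auto simp: dist_norm)
    then show "s \<in> (\<lambda>h. h - g) ` subdifferential J x"
      by (rule image_eqI[rotated]) simp
  qed
  then have "subdiff_gauge J x g v < \<infinity>" if "v \<in> model_S J x" for v
    unfolding subdiff_gauge_def
    using minkowski_gauge_finite_linear[OF subspace_model_S[OF J] r(1) _ that] by blast
  moreover have "0 \<le> subdiff_gauge J x g v" for v
    unfolding subdiff_gauge_def by (rule minkowski_gauge_nonneg)
  ultimately show ?thesis unfolding finite_on_def by fastforce
qed

lemma norm_le_subdiff_gauge:
  fixes J :: "'a::euclidean_space \<Rightarrow> real"
  assumes "convex_on UNIV J"
  obtains K where "0 < K" "\<And>v. ereal (norm v) \<le> ereal K * subdiff_gauge J x g v"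
proof -
  obtain K where K: "0 < K" "\<And>h. h \<in> subdifferential J x \<Longrightarrow> norm h \<le> K"
    using subdifferential_bounded[OF assms] by metis
  have "(\<lambda>h. h - g) ` subdifferential J x \<subseteq> cball 0 (K + norm g)"
    using K(2) norm_triangle_ineq4[of _ g] by (force intro: order_trans)
  then show ?thesis
    using that[of "K + norm g"] norm_le_minkowski_gauge[of "K + norm g"] K(1)
    unfolding subdiff_gauge_def by (metis add_pos_nonneg norm_ge_zero)
qed

lemma subdiff_gauge_pos:
  fixes J :: "'a::euclidean_space \<Rightarrow> real"
  assumes J: "convex_on UNIV J" and g: "g \<in> rel_interior (subdifferential J x)"
    and v: "v \<in> model_S J x" "v \<noteq> 0"
  obtains r where "0 < r" "subdiff_gauge J x g v = ereal r"
proof -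
  obtain r where r: "0 \<le> r" "subdiff_gauge J x g v = ereal r"
    using finite_on_realE[OF is_gauge_subdiff_gauge finite_on_subdiff_gauge[OF J g] v(1)] g
    by (auto simp: mem_rel_interior_cball)
  obtain K where "ereal (norm v) \<le> ereal K * subdiff_gauge J x g v"
    using norm_le_subdiff_gauge[OF J] by metis
  then have "r \<noteq> 0" using r v(2) by auto
  then show ?thesis using that r by simp
qed

lemma subdiff_gauge_comp_adjoint_le:
  fixes D :: "'b::euclidean_space \<Rightarrow> 'a::euclidean_space"
  assumes "convex_on UNIV J0" and D: "linear D"
  shows "subdiff_gauge (\<lambda>y. J0 (adjoint D y)) y (D g) (D w) \<le> subdiff_gauge J0 (adjoint D y) g w"
proof -
  have "(\<lambda>h. h - D g) ` subdifferential (\<lambda>y. J0 (adjoint D y)) y =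
      D ` (\<lambda>h. h - g) ` subdifferential J0 (adjoint D y)"
    by (simp add: subdifferential_comp_adjoint[OF assms] image_image linear_diff[OF D])
  then show ?thesis
    unfolding subdiff_gauge_def by (simp add: minkowski_gauge_linear_image[OF D])
qed

text \<open>The subdifferential of the composition is closed, so its gauge is attained at a scaled subgradient;
  the chain rule lifts that subgradient, and with it \<open>v\<close>, through \<open>D\<close>.\<close>

lemma subdiff_gauge_comp_adjoint_attained:
  fixes D :: "'b::euclidean_space \<Rightarrow> 'a::euclidean_space"
  assumes J0: "convex_on UNIV J0" and D: "linear D"
    and g: "g \<in> subdifferential J0 (adjoint D y)"
    and v: "subdiff_gauge (\<lambda>y. J0 (adjoint D y)) y (D g) v = ereal r" "0 < r"
  obtains w where "w \<in> model_S J0 (adjoint D y)" "D w = v"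
    "subdiff_gauge J0 (adjoint D y) g w \<le> ereal r"
proof -
  let ?J = "\<lambda>y. J0 (adjoint D y)"
  have "closed ((\<lambda>h. h - D g) ` subdifferential ?J y)"
    by (intro closed_translation_subtract closed_subdifferential)
  then have "v \<in> (\<lambda>c. r *\<^sub>R c) ` (\<lambda>h. h - D g) ` subdifferential ?J y"
    using v unfolding subdiff_gauge_def by (intro minkowski_gauge_attained)
  then obtain h where h: "h \<in> subdifferential J0 (adjoint D y)" "v = r *\<^sub>R (D h - D g)"
    unfolding subdifferential_comp_adjoint[OF J0 D] by auto
  show ?thesis
  proof (rule that)
    show "r *\<^sub>R (h - g) \<in> model_S J0 (adjoint D y)"
      using h g by (intro subspace_scale subspace_model_S diff_in_model_S J0 hull_inc)
    show "D (r *\<^sub>R (h - g)) = v"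
      by (simp add: h(2) linear_scale[OF D] linear_diff[OF D])
    show "subdiff_gauge J0 (adjoint D y) g (r *\<^sub>R (h - g)) \<le> ereal r"
      unfolding subdiff_gauge_def using h(1) v(2) by (intro minkowski_gauge_le) auto
  qed
qed

lemma excess_ratio_le_iff:
  assumes "0 \<le> a" "0 < b"
  shows "(a - ereal b) / ereal b \<le> ereal c \<longleftrightarrow> a \<le> ereal ((1 + c) * b)"
  using assms by (cases a) (auto simp: divide_ereal_def field_simps)

text \<open>Comparing the gauges at a minimal preimage \<open>w\<close> of \<open>v\<close>: the gauge at \<open>y\<close> of \<open>v\<close> equals that of \<open>w\<close>,
  and the gauge at \<open>y'\<close> of \<open>v\<close> is at most that of \<open>w\<close>. So the relative excess does not grow.\<close>

lemma excess_ratio_comp_adjoint: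
  fixes D :: "'b::euclidean_space \<Rightarrow> 'a::euclidean_space"
  assumes J0: "convex_on UNIV J0" and D: "linear D"
    and g: "g \<in> rel_interior (subdifferential J0 (adjoint D y))"
    and c: "0 \<le> c"
    and excess: "(SUP w\<in>model_S J0 (adjoint D y) - {0}.
      (subdiff_gauge J0 (adjoint D y') g' w - subdiff_gauge J0 (adjoint D y) g w)
        / subdiff_gauge J0 (adjoint D y) g w) \<le> ereal c"
  defines "J \<equiv> \<lambda>y. J0 (adjoint D y)"
  shows "(SUP v\<in>model_S J y - {0}.
      (subdiff_gauge J y' (D g') v - subdiff_gauge J y (D g) v)
        / subdiff_gauge J y (D g) v) \<le> ereal c"
proof (rule SUP_least)
  fix v assume v: "v \<in> model_S J y - {0}"
  have J: "convex_on UNIV J"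
    unfolding J_def by (rule convex_on_comp_linear[OF J0 adjoint_linear[OF D]])
  have Dg: "D g \<in> rel_interior (subdifferential J y)"
    using g rel_interior_convex_linear_image[OF D convex_subdifferential]
    unfolding J_def subdifferential_comp_adjoint[OF J0 D] by blast
  obtain r where r: "0 < r" "subdiff_gauge J y (D g) v = ereal r"
    using subdiff_gauge_pos[OF J Dg, of v] v by auto
  have gJ: "g \<in> subdifferential J0 (adjoint D y)"
    using g rel_interior_subset by blast
  obtain w where w: "w \<in> model_S J0 (adjoint D y)" "D w = v"
      "subdiff_gauge J0 (adjoint D y) g w \<le> ereal r"
    using subdiff_gauge_comp_adjoint_attained[OF J0 D gJ r(2)[unfolded J_def] r(1)] .
  have "w \<noteq> 0" using w(2) v linear_0[OF D] by auto
  then obtain s where s: "0 < s" "subdiff_gauge J0 (adjoint D y) g w = ereal s"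
    using subdiff_gauge_pos[OF J0 g w(1)] by metis
  have nonneg: "0 \<le> subdiff_gauge J0 (adjoint D y') g' w"
    by (simp add: subdiff_gauge_def minkowski_gauge_nonneg)
  have nonneg': "0 \<le> subdiff_gauge J y' (D g') v"
    by (simp add: subdiff_gauge_def minkowski_gauge_nonneg)
  have "(subdiff_gauge J0 (adjoint D y') g' w - ereal s) / ereal s \<le> ereal c"
    using excess w(1) \<open>w \<noteq> 0\<close> s(2) unfolding SUP_le_iff by force
  then have "subdiff_gauge J0 (adjoint D y') g' w \<le> ereal ((1 + c) * s)"
    by (simp add: excess_ratio_le_iff[OF nonneg s(1)])
  also have "\<dots> \<le> ereal ((1 + c) * r)"
    using w(3) s(2) c by simp
  finally have "subdiff_gauge J y' (D g') v \<le> ereal ((1 + c) * r)"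
    using subdiff_gauge_comp_adjoint_le[OF J0 D, of y' g' w] w(2) unfolding J_def by (metis order_trans)
  then show "(subdiff_gauge J y' (D g') v - subdiff_gauge J y (D g) v) / subdiff_gauge J y (D g) v \<le> ereal c"
    by (simp add: r(2) excess_ratio_le_iff[OF nonneg' r(1)])
qed

section \<open>Composition with a linear map\<close>

lemma proj_model_T_diff:
  assumes J: "convex_on UNIV J" and T: "model_T J y' = model_T J y"
    and g: "g \<in> affine hull subdifferential J y" "g' \<in> affine hull subdifferential J y'"
  shows "closest_point (model_T J y) (g - g') = model_vector J y - model_vector J y'"
  using proj_model_T_eq_model_vector[OF J g(1)] proj_model_T_eq_model_vector[OF J g(2)]
  by (simp add: linear_diff[OF linear_proj[OF subspace_model_T]] T)

text \<open>All that matters about the pseudo-inverse is that it lifts \<open>S\<close> linearly into \<open>S0\<close>; \<open>Q\<close> is any such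
  lift.\<close>

proposition PSFL_comp_adjoint:
  fixes D :: "'b::euclidean_space \<Rightarrow> 'a::euclidean_space" and Q :: "'a \<Rightarrow> 'b"
    and J0 :: "'b \<Rightarrow> real" and x :: 'a and f0 :: "'b \<Rightarrow> 'b"
    and \<Gamma> :: "'a \<Rightarrow> ereal" and \<Gamma>0 :: "'b \<Rightarrow> ereal" and \<nu> \<nu>0 :: real
  defines "A \<equiv> adjoint D"
  defines "J \<equiv> \<lambda>y. J0 (A y)"
  defines "S \<equiv> model_S J x" and "T \<equiv> model_T J x"
    and "S0 \<equiv> model_S J0 (A x)" and "T0 \<equiv> model_T J0 (A x)"
    and "G0 \<equiv> subdiff_gauge J0 (A x) (f0 (A x))"
  defines "B_D \<equiv> op_bound T \<Gamma> \<Gamma>0 A"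
    and "B_PTD \<equiv> op_bound T0 \<Gamma>0 \<Gamma> (\<lambda>w. closest_point T (D w))"
    and "B_SS \<equiv> op_bound S0 G0 G0 (\<lambda>w. Q (closest_point S (D w)))"
    and "B_TS \<equiv> op_bound T0 \<Gamma>0 G0 (\<lambda>w. Q (closest_point S (D w)))"
  assumes D: "linear D" and Q: "linear Q"
    and Q_S: "\<And>s. s \<in> S \<Longrightarrow> Q s \<in> S0" "\<And>s. s \<in> S \<Longrightarrow> D (Q s) = s"
    and psfl: "PSFL J0 (A x) \<Gamma>0 f0 \<nu>0 \<mu>0 \<tau>0 \<xi>0"
    and \<Gamma>: "is_gauge \<Gamma>" "finite_on UNIV \<Gamma>" "coercive_on T \<Gamma>"
    and \<nu>: "0 \<le> \<nu>" "B_D \<noteq> 0 \<longrightarrow> ereal \<nu> = ereal \<nu>0 / B_D"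
  shows "\<exists>\<mu> \<tau> \<xi> :: real.
    ereal \<mu> = ereal \<mu>0 * B_PTD * B_D \<and>
    ereal \<tau> = (ereal \<tau>0 * B_SS + ereal \<mu>0 * B_TS) * B_D \<and>
    ereal \<xi> = ereal \<xi>0 * B_D \<and>
    PSFL J x \<Gamma> (\<lambda>x'. D (f0 (A x'))) \<nu> \<mu> \<tau> \<xi>"
proof -
  define u where "u = A x"
  have A: "linear A" unfolding A_def by (rule adjoint_linear[OF D])
  have \<Gamma>0: "is_gauge \<Gamma>0" "finite_on T0 \<Gamma>0" "coercive_on T0 \<Gamma>0"
    and nonneg: "0 \<le> \<nu>0" "0 \<le> \<mu>0" "0 \<le> \<tau>0" "0 \<le> \<xi>0"
    and J0: "convex_on UNIV J0"
    and ps0: "partly_smooth J0 u T0"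
    and lip0: "setvalued_lipschitz_around_rel (subdifferential J0) u T0"
    and nbhd0: "\<exists>W U L. open U \<and> u \<in> U \<and> T0 \<inter> U \<subseteq> W \<and> W \<subseteq> T0 \<and>
          {u'\<in>T0. \<Gamma>0 (u - u') < ereal \<nu>0} \<subseteq> W \<and>
          (\<forall>u'\<in>W. f0 u' \<in> rel_interior (subdifferential J0 u')) \<and> L-lipschitz_on W f0"
    and T0_const: "\<And>u'. u' \<in> T0 \<Longrightarrow> \<Gamma>0 (u - u') \<le> ereal \<nu>0 \<Longrightarrow> model_T J0 u' = T0"
    and ineqs0: "\<And>u'. u' \<in> T0 \<Longrightarrow> \<Gamma>0 (u - u') < ereal \<nu>0 \<Longrightarrow>
        \<Gamma>0 (model_vector J0 u - model_vector J0 u') \<le> ereal \<mu>0 * \<Gamma>0 (u - u') \<and>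
        G0 (closest_point S0 (f0 u - f0 u')) \<le> ereal \<tau>0 * \<Gamma>0 (u - u') \<and>
        (SUP w\<in>S0 - {0}. (subdiff_gauge J0 u' (f0 u') w - G0 w) / G0 w) \<le> ereal \<xi>0 * \<Gamma>0 (u - u')"
    using psfl unfolding PSFL_def Let_def T0_def S0_def G0_def u_def by simp_all
  obtain W0 U0 L where W0: "open U0" "u \<in> U0" "T0 \<inter> U0 \<subseteq> W0" "W0 \<subseteq> T0"
      "{u'\<in>T0. \<Gamma>0 (u - u') < ereal \<nu>0} \<subseteq> W0"
      "\<And>u'. u' \<in> W0 \<Longrightarrow> f0 u' \<in> rel_interior (subdifferential J0 u')"
      "L-lipschitz_on W0 f0"
    using nbhd0 by (elim exE conjE) (rule that, auto)
  have u_T0: "u \<in> T0" using ps0 by (simp add: partly_smooth_def)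
  then have u_W0: "u \<in> W0" using W0 by blast
  have f0u: "f0 u \<in> rel_interior (subdifferential J0 u)" by (rule W0(6)[OF u_W0])
  have J: "convex_on UNIV J" unfolding J_def by (rule convex_on_comp_linear[OF J0 A])
  have subd: "subdifferential J y = D ` subdifferential J0 (A y)" for y
    unfolding J_def A_def by (rule subdifferential_comp_adjoint[OF J0 D])
  have T_comp: "model_T J y = A -` model_T J0 (A y)" for y
    unfolding J_def A_def by (rule model_T_comp_adjoint[OF J0 D])
  have T: "T = A -` T0" unfolding T_def T0_def by (rule T_comp)
  have S: "S = D ` S0" unfolding S_def S0_def J_def A_def by (rule model_S_comp_adjoint[OF J0 D])
  have subspaces: "subspace T" "subspace T0" "subspace S" "subspace S0"
    unfolding T_def T0_def S_def S0_def by (simp_all add: subspace_model_T subspace_model_S J J0)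

  have gauge_G0: "is_gauge G0" "finite_on S0 G0"
    using is_gauge_subdiff_gauge finite_on_subdiff_gauge[OF J0 f0u] f0u rel_interior_subset
    unfolding G0_def S0_def u_def by blast+
  have fin\<Gamma>: "finite_on V \<Gamma>" for V using \<Gamma>(2) by (simp add: finite_on_def)
  obtain K where K: "0 < K" "\<And>v. v \<in> T \<Longrightarrow> ereal (norm v) \<le> ereal K * \<Gamma> v"
    using norm_le_coercive_gauge[OF \<Gamma>(1) subspaces(1) \<Gamma>(3)] by metis
  obtain K0 where K0: "0 < K0" "\<And>v. v \<in> T0 \<Longrightarrow> ereal (norm v) \<le> ereal K0 * \<Gamma>0 v"
    using norm_le_coercive_gauge[OF \<Gamma>0(1) subspaces(2) \<Gamma>0(3)] by metis
  obtain KG where KG: "0 < KG" "\<And>v. ereal (norm v) \<le> ereal KG * G0 v"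
    using norm_le_subdiff_gauge[OF J0] unfolding G0_def by metis
  have lin_TD: "linear (\<lambda>w. closest_point T (D w))"
    using linear_compose[OF D linear_proj[OF subspaces(1)]] by (simp add: o_def)
  have lin_QSD: "linear (\<lambda>w. Q (closest_point S (D w)))"
    using linear_compose[OF linear_compose[OF D linear_proj[OF subspaces(3)]] Q] by (simp add: o_def)
  have QSD_in: "Q (closest_point S (D w)) \<in> S0" for w
    by (intro Q_S(1) proj_in subspaces)
  obtain bD where bD: "0 \<le> bD" "B_D = ereal bD" "\<And>v. v \<in> T \<Longrightarrow> \<Gamma>0 (A v) \<le> ereal bD * \<Gamma> v"
    unfolding B_D_def
    using op_bound_finite[OF \<Gamma>(1) \<Gamma>0(1) subspaces(1,2) fin\<Gamma> \<Gamma>0(2) K A] T by auto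
  obtain bP where bP: "0 \<le> bP" "B_PTD = ereal bP"
      "\<And>w. w \<in> T0 \<Longrightarrow> \<Gamma> (closest_point T (D w)) \<le> ereal bP * \<Gamma>0 w"
    unfolding B_PTD_def
    using op_bound_finite[OF \<Gamma>0(1) \<Gamma>(1) subspaces(2,1) \<Gamma>0(2) fin\<Gamma> K0 lin_TD] proj_in[OF subspaces(1)]
    by metis
  obtain bS where bS: "0 \<le> bS" "B_SS = ereal bS"
      "\<And>w. w \<in> S0 \<Longrightarrow> G0 (Q (closest_point S (D w))) \<le> ereal bS * G0 w"
    unfolding B_SS_def
    using op_bound_finite[OF gauge_G0(1) gauge_G0(1) subspaces(4,4) gauge_G0(2) gauge_G0(2) KG lin_QSD] QSD_in
    by metis
  obtain bT where bT: "0 \<le> bT" "B_TS = ereal bT"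
      "\<And>w. w \<in> T0 \<Longrightarrow> G0 (Q (closest_point S (D w))) \<le> ereal bT * \<Gamma>0 w"
    unfolding B_TS_def
    using op_bound_finite[OF \<Gamma>0(1) gauge_G0(1) subspaces(2,4) \<Gamma>0(2) gauge_G0(2) K0 lin_QSD] QSD_in
    by metis

  have A_diff: "A x - A x' = A (x - x')" for x' by (simp add: linear_diff[OF A])
  have x_T: "x \<in> T" using u_T0 by (simp add: T u_def)
  have bound: "\<Gamma>0 (u - A x') \<le> ereal bD * \<Gamma> (x - x')" if "x' \<in> T" for x'
    unfolding u_def A_diff by (intro bD(3) subspace_diff subspaces x_T that)
  \<comment> \<open>If the bound of \<open>A\<close> on \<open>T\<close> vanishes, then so does \<open>A\<close>, because \<open>\<Gamma>0\<close> is coercive.\<close>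
  have degenerate: "A x' = u" if x': "x' \<in> T" and "bD = 0" for x'
  proof -
    have "\<Gamma>0 (u - A x') \<le> 0" using bound[OF x'] that by (simp flip: zero_ereal_def)
    then have "\<Gamma>0 (u - A x') = 0" using gauge_nonneg[OF \<Gamma>0(1)] by (rule antisym)
    moreover have "u - A x' \<in> T0" using u_T0 x' subspaces by (auto simp: T intro: subspace_diff)
    ultimately have "ereal (norm (u - A x')) \<le> 0" using K0(2)[of "u - A x'"] by simp
    then show ?thesis by simp
  qed
  have \<nu>_bD: "bD * \<nu> = \<nu>0" if "bD \<noteq> 0"
    using \<nu>(2) that bD(2) by (simp add: field_simps)
  have closed_region: "A x' = u \<or> \<Gamma>0 (u - A x') \<le> ereal \<nu>0"
    if "x' \<in> T" "\<Gamma> (x - x') \<le> ereal \<nu>" for x'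
  proof (cases "bD = 0")
    case False
    have "\<Gamma>0 (u - A x') \<le> ereal bD * \<Gamma> (x - x')" by (rule bound[OF that(1)])
    also have "\<dots> \<le> ereal bD * ereal \<nu>" using that(2) bD(1) by (intro ereal_mult_left_mono) auto
    finally show ?thesis using \<nu>_bD[OF False] by simp
  qed (use degenerate that in simp)
  have open_region: "A x' = u \<or> \<Gamma>0 (u - A x') < ereal \<nu>0"
    if "x' \<in> T" "\<Gamma> (x - x') < ereal \<nu>" for x'
  proof (cases "bD = 0")
    case False
    obtain r where r: "\<Gamma> (x - x') = ereal r"
      using finite_on_realE[OF \<Gamma>(1,2)] by blast
    have "\<Gamma>0 (u - A x') \<le> ereal (bD * r)" using bound[OF that(1)] r by simp
    also have "bD * r < bD * \<nu>" using that(2) r bD(1) False by simp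
    finally show ?thesis using \<nu>_bD[OF False] by simp
  qed (use degenerate that in simp)

  have T_const: "model_T J x' = T" if "x' \<in> T" "\<Gamma> (x - x') \<le> ereal \<nu>" for x'
  proof -
    have "model_T J0 (A x') = T0"
      using closed_region[OF that] T0_const[of "A x'"] that(1) by (auto simp: T T0_def u_def)
    then show ?thesis by (simp add: T_comp T)
  qed

  \<comment> \<open>The inequalities of \<open>J0\<close> also hold trivially at \<open>u\<close> itself, even when \<open>\<nu>0 = 0\<close> and the
    open region around \<open>u\<close> is empty.\<close>
  have near: "A x' \<in> W0 \<and>
      \<Gamma>0 (model_vector J0 u - model_vector J0 (A x')) \<le> ereal \<mu>0 * \<Gamma>0 (u - A x') \<and>
      G0 (closest_point S0 (f0 u - f0 (A x'))) \<le> ereal \<tau>0 * \<Gamma>0 (u - A x') \<and>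
      (SUP w\<in>S0 - {0}. (subdiff_gauge J0 (A x') (f0 (A x')) w - G0 w) / G0 w)
        \<le> ereal \<xi>0 * \<Gamma>0 (u - A x')"
    if x': "x' \<in> T" "\<Gamma> (x - x') < ereal \<nu>" for x'
    using open_region[OF x']
  proof
    assume "\<Gamma>0 (u - A x') < ereal \<nu>0"
    then show ?thesis using ineqs0[of "A x'"] W0(5) x'(1) T by blast
  next
    assume eq: "A x' = u"
    have "(subdiff_gauge J0 (A x') (f0 (A x')) w - G0 w) / G0 w = 0" if w: "w \<in> S0 - {0}" for w
    proof -
      obtain r where "G0 w = ereal r"
        using finite_on_realE[OF gauge_G0] w by blast
      then show ?thesis unfolding eq unfolding u_def G0_def[symmetric] by simp
    qed
    then have "(SUP w\<in>S0 - {0}. (subdiff_gauge J0 (A x') (f0 (A x')) w - G0 w) / G0 w) \<le> 0"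
      by (intro SUP_least) simp
    then show ?thesis
      using u_W0 by (simp add: eq gauge_zero[OF \<Gamma>0(1)] gauge_zero[OF gauge_G0(1)]
          linear_0[OF linear_proj[OF subspaces(4)]])
  qed

  define \<mu> where "\<mu> = \<mu>0 * bP * bD"
  define \<tau> where "\<tau> = (\<tau>0 * bS + \<mu>0 * bT) * bD"
  define \<xi> where "\<xi> = \<xi>0 * bD"
  have ineqs: "\<Gamma> (model_vector J x - model_vector J x') \<le> ereal \<mu> * \<Gamma> (x - x') \<and>
      subdiff_gauge J x (D (f0 (A x))) (closest_point S (D (f0 (A x)) - D (f0 (A x'))))
        \<le> ereal \<tau> * \<Gamma> (x - x') \<and>
      (SUP v\<in>S - {0}.
        (subdiff_gauge J x' (D (f0 (A x'))) v - subdiff_gauge J x (D (f0 (A x))) v)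
          / subdiff_gauge J x (D (f0 (A x))) v) \<le> ereal \<xi> * \<Gamma> (x - x')"
    if x': "x' \<in> T" "\<Gamma> (x - x') < ereal \<nu>" for x'
  proof -
    define u' where "u' = A x'"
    define d where "d = model_vector J0 u - model_vector J0 u'"
    have u'_T0: "u' \<in> T0" using x'(1) by (simp add: T u'_def)
    have u'_T: "model_T J0 u' = T0"
      using open_region[OF x'] T0_const[of "A x'"] u'_T0 by (auto simp: u'_def T0_def u_def)
    have x'_T: "model_T J x' = T" using T_const x' by simp
    obtain r where r: "0 \<le> r" "\<Gamma> (x - x') = ereal r"
      using finite_on_realE[OF \<Gamma>(1,2)] by blast
    have "u - u' \<in> T0" by (intro subspace_diff subspaces u_T0 u'_T0)
    then obtain r0 where r0: "0 \<le> r0" "\<Gamma>0 (u - u') = ereal r0"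
      using finite_on_realE[OF \<Gamma>0(1,2)] by blast
    have r0_le: "r0 \<le> bD * r" using bound[OF x'(1)] r r0 by (simp add: u'_def)
    have d_T0: "d \<in> T0"
      using model_vector_in_model_T[OF J0, of u] model_vector_in_model_T[OF J0, of u'] u'_T subspaces(2)
      unfolding d_def T0_def u_def by (auto intro: subspace_diff)
    then obtain m where m: "0 \<le> m" "\<Gamma>0 d = ereal m"
      using finite_on_realE[OF \<Gamma>0(1,2)] by blast
    have m_le: "m \<le> \<mu>0 * r0"
      using near[OF x'] m(2) r0(2) by (simp add: d_def u'_def)
    have hull: "model_vector J0 y \<in> affine hull subdifferential J0 y" for y
      by (rule model_vector_in_affine_hull[OF J0])
    have hullD: "D g \<in> affine hull subdifferential J y"
      if "g \<in> affine hull subdifferential J0 (A y)" for g y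
      using that D by (auto simp: subd affine_hull_linear_image[symmetric] linear_conv_bounded_linear)
    have "model_vector J x - model_vector J x' = closest_point T (D (model_vector J0 u) - D (model_vector J0 u'))"
      unfolding T_def using x'_T hullD[OF hull] hullD[OF hull]
      by (intro proj_model_T_diff[symmetric] J) (auto simp: u_def u'_def T_def)
    also have "\<dots> = closest_point T (D d)" by (simp add: d_def linear_diff[OF D])
    finally have "\<Gamma> (model_vector J x - model_vector J x') \<le> ereal (bP * m)"
      using bP(3)[OF d_T0] m by simp
    also have "bP * m \<le> bP * (\<mu>0 * (bD * r))"
      using m_le r0_le bP(1) nonneg(2) by (meson mult_left_mono order_trans)
    finally have 1: "\<Gamma> (model_vector J x - model_vector J x') \<le> ereal \<mu> * \<Gamma> (x - x')"
      by (simp add: r \<mu>_def mult_ac)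

    define h where "h = f0 u - f0 u'"
    define s where "s = closest_point S0 h"
    have s_S0: "s \<in> S0" unfolding s_def by (rule proj_in[OF subspaces(4)])
    then obtain t where t: "0 \<le> t" "G0 s = ereal t"
      using finite_on_realE[OF gauge_G0] by blast
    have t_le: "t \<le> \<tau>0 * r0" using near[OF x'] t(2) r0(2) by (simp add: s_def h_def u'_def)
    have u'_W0: "u' \<in> W0" using near[OF x'] by (simp add: u'_def)
    have "f0 y \<in> affine hull subdifferential J0 y" if "y \<in> W0" for y
      using subsetD[OF rel_interior_subset W0(6)[OF that]] by (rule hull_inc)
    then have "closest_point T0 h = d"
      unfolding h_def d_def T0_def u_def[symmetric] using u'_T u_W0 u'_W0
      by (intro proj_model_T_diff J0) (auto simp: T0_def u_def)
    then have h: "h = s + d"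
      using proj_add_proj_orthogonal_comp[OF subspaces(4), of h]
      by (simp add: s_def T0_def model_T_def S0_def)
    define q where "q w = Q (closest_point S (D w))" for w
    have "D (q h) = closest_point S (D h)"
      unfolding q_def by (intro Q_S(2) proj_in subspaces)
    then have "subdiff_gauge J x (D (f0 u)) (closest_point S (D h)) \<le> G0 (q h)"
      using subdiff_gauge_comp_adjoint_le[OF J0 D, of x "f0 u" "q h"]
      by (simp add: J_def A_def G0_def u_def)
    also have "\<dots> = G0 (q s + q d)"
      unfolding h q_def by (simp add: linear_add[OF lin_QSD])
    also have "\<dots> \<le> G0 (q s) + G0 (q d)" by (rule gauge_add[OF gauge_G0(1)])
    also have "\<dots> \<le> ereal (bS * t) + ereal (bT * m)"
      unfolding q_def using bS(3)[OF s_S0] bT(3)[OF d_T0] t m by (intro add_mono) simp_all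
    also have "\<dots> = ereal (bS * t + bT * m)" by simp
    also have "bS * t + bT * m \<le> bS * (\<tau>0 * r0) + bT * (\<mu>0 * r0)"
      using t_le m_le bS(1) bT(1) by (intro add_mono mult_left_mono)
    also have "\<dots> = (\<tau>0 * bS + \<mu>0 * bT) * r0" by (simp add: algebra_simps)
    also have "\<dots> \<le> (\<tau>0 * bS + \<mu>0 * bT) * (bD * r)"
      using r0_le nonneg bS(1) bT(1) by (intro mult_left_mono) auto
    finally have 2: "subdiff_gauge J x (D (f0 (A x))) (closest_point S (D (f0 (A x)) - D (f0 (A x'))))
        \<le> ereal \<tau> * \<Gamma> (x - x')"
      by (simp add: r \<tau>_def h_def u_def u'_def linear_diff[OF D] mult_ac)

    have "(SUP v\<in>S - {0}.
        (subdiff_gauge J x' (D (f0 (A x'))) v - subdiff_gauge J x (D (f0 (A x))) v)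
          / subdiff_gauge J x (D (f0 (A x))) v) \<le> ereal (\<xi>0 * r0)"
      unfolding J_def A_def S_def
    proof (rule excess_ratio_comp_adjoint[OF J0 D])
      show "f0 (adjoint D x) \<in> rel_interior (subdifferential J0 (adjoint D x))"
        using f0u by (simp add: u_def A_def)
      show "0 \<le> \<xi>0 * r0" using nonneg r0 by simp
      show "(SUP w\<in>model_S J0 (adjoint D x) - {0}.
          (subdiff_gauge J0 (adjoint D x') (f0 (adjoint D x')) w
             - subdiff_gauge J0 (adjoint D x) (f0 (adjoint D x)) w)
            / subdiff_gauge J0 (adjoint D x) (f0 (adjoint D x)) w) \<le> ereal (\<xi>0 * r0)"
        using near[OF x'] r0(2) by (simp add: u'_def S0_def G0_def A_def)
    qed
    also have "\<xi>0 * r0 \<le> \<xi>0 * (bD * r)" using r0_le nonneg by (intro mult_left_mono)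
    finally have 3: "(SUP v\<in>S - {0}.
        (subdiff_gauge J x' (D (f0 (A x'))) v - subdiff_gauge J x (D (f0 (A x))) v)
          / subdiff_gauge J x (D (f0 (A x))) v) \<le> ereal \<xi> * \<Gamma> (x - x')"
      by (simp add: r \<xi>_def mult_ac)
    show ?thesis using 1 2 3 by blast
  qed

  have nbhd: "\<exists>W U L. open U \<and> x \<in> U \<and> T \<inter> U \<subseteq> W \<and> W \<subseteq> T \<and>
      {x'\<in>T. \<Gamma> (x - x') < ereal \<nu>} \<subseteq> W \<and>
      (\<forall>x'\<in>W. D (f0 (A x')) \<in> rel_interior (subdifferential J x')) \<and>
      L-lipschitz_on W (\<lambda>x'. D (f0 (A x')))"
  proof -
    obtain a where a: "0 < a" "\<And>v. norm (A v) \<le> a * norm v"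
      using linear_bounded_pos[OF A] by metis
    obtain d where d: "0 < d" "\<And>v. norm (D v) \<le> d * norm v"
      using linear_bounded_pos[OF D] by metis
    have L: "0 \<le> L" using W0(7) by (rule lipschitz_on_nonneg)
    have "open (A -` U0)"
      using A W0(1) by (intro continuous_open_vimage) (auto simp: linear_continuous_at linear_conv_bounded_linear)
    moreover have "(d * L * a)-lipschitz_on (A -` W0) (\<lambda>x'. D (f0 (A x')))"
    proof (rule lipschitz_onI)
      fix y z assume yz: "y \<in> A -` W0" "z \<in> A -` W0"
      have "dist (D (f0 (A y))) (D (f0 (A z))) \<le> d * dist (f0 (A y)) (f0 (A z))"
        using d(2)[of "f0 (A y) - f0 (A z)"] by (simp add: dist_norm linear_diff[OF D])
      also have "\<dots> \<le> d * (L * dist (A y) (A z))"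
        using lipschitz_onD[OF W0(7), of "A y" "A z"] yz d(1) by simp
      also have "\<dots> \<le> d * (L * (a * dist y z))"
        using a(2)[of "y - z"] d(1) L by (intro mult_left_mono) (auto simp: dist_norm linear_diff[OF A])
      finally show "dist (D (f0 (A y))) (D (f0 (A z))) \<le> d * L * a * dist y z"
        by (simp add: mult.assoc)
    qed (use d(1) a(1) L in simp)
    moreover have "D (f0 (A y)) \<in> rel_interior (subdifferential J y)" if "A y \<in> W0" for y
      using W0(6)[OF that] rel_interior_convex_linear_image[OF D convex_subdifferential]
      unfolding subd by blast
    moreover have "{x'\<in>T. \<Gamma> (x - x') < ereal \<nu>} \<subseteq> A -` W0"
      using near by blast
    ultimately show ?thesis
      using W0(2,3,4) unfolding u_def T
      by (intro exI[of _ "A -` W0"] exI[of _ "A -` U0"] exI[of _ "d * L * a"]) auto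
  qed

  have "partly_smooth J x T"
    using partly_smooth_comp_adjoint[OF D, of J0 x] ps0 by (simp add: J_def A_def T_def T0_def u_def)
  moreover have "setvalued_lipschitz_around_rel (subdifferential J) x T"
    using setvalued_lipschitz_comp_adjoint[OF J0 D, of x T0] lip0 by (simp add: J_def A_def T u_def)
  moreover have "0 \<le> \<mu>" "0 \<le> \<tau>" "0 \<le> \<xi>"
    using nonneg bD(1) bP(1) bS(1) bT(1) by (simp_all add: \<mu>_def \<tau>_def \<xi>_def)
  ultimately have "PSFL J x \<Gamma> (\<lambda>x'. D (f0 (A x'))) \<nu> \<mu> \<tau> \<xi>"
    unfolding PSFL_def Let_def S_def[symmetric] T_def[symmetric]
    using \<Gamma> fin\<Gamma> \<nu>(1) J nbhd T_const ineqs by blast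
  moreover have "ereal \<mu> = ereal \<mu>0 * B_PTD * B_D"
    "ereal \<tau> = (ereal \<tau>0 * B_SS + ereal \<mu>0 * B_TS) * B_D" "ereal \<xi> = ereal \<xi>0 * B_D"
    by (simp_all add: \<mu>_def \<tau>_def \<xi>_def bD(2) bP(2) bS(2) bT(2))
  ultimately show ?thesis by blast
qed

section \<open>The Moore--Penrose inverse\<close>

definition moore_penrose :: "real^'n^'m \<Rightarrow> real^'m^'n \<Rightarrow> bool" where
  "moore_penrose A X \<longleftrightarrow> A ** X ** A = A \<and> X ** A ** X = X \<and>
     transpose (A ** X) = A ** X \<and> transpose (X ** A) = X ** A"

text \<open>Both \<open>A ** X\<close> and \<open>A ** Y\<close> are symmetric and act as the identity on the columns of \<open>A\<close>, which makes
  them equal; likewise \<open>X ** A\<close> and \<open>Y ** A\<close>. Then \<open>X = X ** A ** X = Y ** A ** Y = Y\<close>.\<close>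

lemma moore_penrose_unique:
  assumes X: "moore_penrose A X" and Y: "moore_penrose A Y"
  shows "X = Y"
proof -
  have left: "A ** X = A ** Y"
  proof -
    have "A ** X = transpose (A ** Y ** A ** X)"
      using X Y by (simp add: moore_penrose_def)
    also have "\<dots> = transpose (A ** X) ** transpose (A ** Y)"
      by (simp add: matrix_mul_assoc flip: matrix_transpose_mul)
    also have "\<dots> = A ** X ** A ** Y"
      using X Y by (simp add: moore_penrose_def matrix_mul_assoc)
    finally show ?thesis using X by (simp add: moore_penrose_def)
  qed
  have right: "X ** A = Y ** A"
  proof -
    have "X ** A = transpose (X ** (A ** Y ** A))"
      using X Y by (simp add: moore_penrose_def)
    also have "\<dots> = transpose (Y ** A) ** transpose (X ** A)"
      by (simp add: matrix_mul_assoc flip: matrix_transpose_mul)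
    also have "\<dots> = Y ** A ** (X ** A)"
      using X Y by (simp add: moore_penrose_def)
    also have "\<dots> = Y ** (A ** X ** A)"
      by (simp only: matrix_mul_assoc)
    finally show ?thesis using X by (simp add: moore_penrose_def)
  qed
  have "X = X ** (A ** X)" using X by (simp add: moore_penrose_def matrix_mul_assoc)
  also have "\<dots> = Y ** A ** Y" by (simp add: left right matrix_mul_assoc)
  also have "\<dots> = Y" using Y by (simp add: moore_penrose_def)
  finally show ?thesis .
qed

lemma transpose_matrix_proj:
  fixes V :: "(real^'n) set"
  assumes "subspace V"
  shows "transpose (matrix (closest_point V)) = matrix (closest_point V)"
proof -
  have "adjoint (closest_point V) = closest_point V"
    by (rule adjoint_unique) (simp add: proj_self_adjoint[OF assms])
  then show ?thesis using matrix_adjoint[OF linear_proj[OF assms]] by simp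
qed

text \<open>\<open>A\<close> maps the row space bijectively onto the column space. Projecting onto the column space and
  inverting this bijection gives \<open>X\<close>; then \<open>A ** X\<close> and \<open>X ** A\<close> are the orthogonal projectors onto
  the two spaces.\<close>

lemma moore_penrose_exists:
  fixes A :: "real^'n^'m"
  shows "\<exists>X. moore_penrose A X"
proof -
  define R where "R = range (\<lambda>y. transpose A *v y)"
  define C where "C = range (\<lambda>z. A *v z)"
  have R: "subspace R" and C: "subspace C"
    unfolding R_def C_def by (intro linear_subspace_image matrix_vector_mul_linear subspace_UNIV)+
  have move: "(A *v z) \<bullet> y = z \<bullet> (transpose A *v y)" for z y
    by (metis dot_lmul_matrix inner_commute vector_transpose_matrix)
  have A_proj: "A *v closest_point R z = A *v z" for z
  proof -
    have "(A *v (z - closest_point R z)) \<bullet> y = 0" for y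
      unfolding move by (intro proj_orthogonal R) (simp add: R_def)
    then have "A *v (z - closest_point R z) = 0" by (metis inner_eq_zero_iff)
    then show ?thesis by (simp add: matrix_vector_mult_diff_distrib)
  qed
  have "inj_on (\<lambda>z. A *v z) R"
  proof (rule inj_onI)
    fix y z assume yz: "y \<in> R" "z \<in> R" "A *v y = A *v z"
    then obtain w where w: "y - z = transpose A *v w"
      using subspace_diff[OF R, of y z] by (auto simp: R_def)
    have "(y - z) \<bullet> (y - z) = (A *v (y - z)) \<bullet> w"
      unfolding move w[symmetric] ..
    then show "y = z" using yz(3) by (simp add: matrix_vector_mult_diff_distrib)
  qed
  then obtain h where h: "range h \<subseteq> R" "linear h" "\<And>z. z \<in> R \<Longrightarrow> h (A *v z) = z"
    using linear_exists_left_inverse_on[OF matrix_vector_mul_linear[of A] R] by blast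
  define X where "X = matrix (\<lambda>y. h (closest_point C y))"
  have "linear (\<lambda>y. h (closest_point C y))"
    using linear_compose[OF linear_proj[OF C] h(2)] by (simp add: o_def)
  then have X: "X *v y = h (closest_point C y)" for y
    by (simp add: X_def matrix_works)
  have XA: "X *v (A *v z) = closest_point R z" for z
  proof -
    have "closest_point C (A *v z) = A *v closest_point R z"
      unfolding A_proj by (intro closest_point_self) (simp add: C_def)
    then show ?thesis using h(3)[OF proj_in[OF R]] by (simp add: X)
  qed
  have AX: "A *v (X *v y) = closest_point C y" for y
  proof -
    obtain z where z: "closest_point C y = A *v z"
      using proj_in[OF C, of y] by (auto simp: C_def)
    then have "X *v y = closest_point R z"
      unfolding X using h(3)[OF proj_in[OF R, of z]] by (simp add: A_proj)
    then show ?thesis by (simp add: z A_proj)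
  qed
  have "A ** X = matrix (closest_point C)"
    by (simp add: matrix_eq matrix_works linear_proj C AX flip: matrix_vector_mul_assoc)
  moreover have "X ** A = matrix (closest_point R)"
    by (simp add: matrix_eq matrix_works linear_proj R XA flip: matrix_vector_mul_assoc)
  moreover have "A ** X ** A = A"
    by (simp add: matrix_eq XA A_proj flip: matrix_vector_mul_assoc)
  moreover have "X ** A ** X = X"
  proof -
    have "X *v y \<in> R" for y using h(1) by (auto simp: X)
    then show ?thesis
      by (simp add: matrix_eq XA closest_point_self flip: matrix_vector_mul_assoc)
  qed
  ultimately have "moore_penrose A X"
    unfolding moore_penrose_def by (simp add: transpose_matrix_proj R C)
  then show ?thesis ..
qed

lemma moore_penrose_pinv: "moore_penrose A (pinv A)"
proof -
  have "\<exists>!X. moore_penrose A X"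
    using moore_penrose_exists moore_penrose_unique by blast
  then show ?thesis
    unfolding pinv_def moore_penrose_def by (rule theI')
qed

lemma pinv_right_inverse:
  assumes "s \<in> range (\<lambda>z. A *v z)"
  shows "A *v (pinv A *v s) = s"
  using assms moore_penrose_pinv[of A] by (auto simp: moore_penrose_def matrix_vector_mul_assoc)

text \<open>The symmetry of \<open>X ** A\<close> turns \<open>X = X ** A ** X\<close> into a product that starts with the transpose of
  \<open>A\<close>.\<close>

lemma pinv_in_row_space: "pinv A *v y \<in> range (\<lambda>y. transpose A *v y)"
proof -
  have "pinv A = transpose (pinv A ** A) ** pinv A"
    using moore_penrose_pinv[of A] by (simp add: moore_penrose_def)
  then have "pinv A *v y = transpose A *v (transpose (pinv A) *v (pinv A *v y))"
    by (metis matrix_transpose_mul matrix_vector_mul_assoc)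
  then show ?thesis by blast
qed

theorem proposition9:
  fixes D :: "real^'p^'n"
    and J0 :: "real^'p \<Rightarrow> real" and J :: "real^'n \<Rightarrow> real"
    and x :: "real^'n" and u :: "real^'p"
    and \<Gamma>0 :: "real^'p \<Rightarrow> ereal" and \<Gamma> :: "real^'n \<Rightarrow> ereal"
    and f0 :: "real^'p \<Rightarrow> real^'p" and f :: "real^'n \<Rightarrow> real^'n"
    and \<nu>0 \<mu>0 \<tau>0 \<xi>0 \<nu> :: real
    and S T :: "(real^'n) set" and S0 T0 :: "(real^'p) set"
    and D_S0 :: "real^'p^'n" and G0 :: "real^'p \<Rightarrow> ereal"
    and B_D B_PTD B_SS B_TS :: ereal
  assumes "convex_on UNIV J0"
    and "u = transpose D *v x"
    and "PSFL J0 u \<Gamma>0 f0 \<nu>0 \<mu>0 \<tau>0 \<xi>0"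
    and "J = (\<lambda>y. J0 (transpose D *v y))"
    and "S = model_S J x" and "T = model_T J x"
    and "S0 = model_S J0 u" and "T0 = model_T J0 u"
    and "D_S0 = D ** matrix (closest_point S0)"
    and "f = (\<lambda>x'. D *v f0 (transpose D *v x'))"
    and "is_gauge \<Gamma>" and "finite_on UNIV \<Gamma>" and "coercive_on T \<Gamma>"
    and "G0 = subdiff_gauge J0 u (f0 u)"
    and "B_D = op_bound T \<Gamma> \<Gamma>0 (\<lambda>v. transpose D *v v)"
    and "B_PTD = op_bound T0 \<Gamma>0 \<Gamma> (\<lambda>w. closest_point T (D *v w))"
    and "B_SS = op_bound S0 G0 G0 (\<lambda>w. pinv D_S0 *v closest_point S (D *v w))"
    and "B_TS = op_bound T0 \<Gamma>0 G0 (\<lambda>w. pinv D_S0 *v closest_point S (D *v w))"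
    and "0 \<le> \<nu>" and "B_D \<noteq> 0 \<longrightarrow> ereal \<nu> = ereal \<nu>0 / B_D"
  shows "\<exists>\<mu> \<tau> \<xi> :: real.
    ereal \<mu> = ereal \<mu>0 * B_PTD * B_D \<and>
    ereal \<tau> = (ereal \<tau>0 * B_SS + ereal \<mu>0 * B_TS) * B_D \<and>
    ereal \<xi> = ereal \<xi>0 * B_D \<and>
    PSFL J x \<Gamma> f \<nu> \<mu> \<tau> \<xi>"
proof -
  let ?D = "\<lambda>w. D *v w" and ?Q = "\<lambda>s. pinv D_S0 *v s"
  have J0: "convex_on UNIV J0" by fact
  have adj: "adjoint ?D = (\<lambda>y. transpose D *v y)" by (rule adjoint_matrix)
  have linD: "linear ?D" by simp
  have S0: "subspace S0" unfolding assms(7) by (rule subspace_model_S[OF J0])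
  have S: "S = ?D ` S0"
    using model_S_comp_adjoint[OF J0 linD, of x] by (simp add: adj assms(2,4,5,7))
  have D_S0: "D_S0 *v w = D *v closest_point S0 w" for w
    by (simp add: assms(9) matrix_works linear_proj S0 flip: matrix_vector_mul_assoc)
  have Q_S0: "?Q s \<in> S0" for s
  proof -
    have "transpose D_S0 *v y = closest_point S0 (transpose D *v y)" for y
      by (simp add: assms(9) matrix_transpose_mul transpose_matrix_proj matrix_works linear_proj S0
          flip: matrix_vector_mul_assoc)
    then show ?thesis using pinv_in_row_space[of D_S0 s] proj_in[OF S0] by auto
  qed
  have D_Q: "?D (?Q s) = s" if s: "s \<in> S" for s
  proof -
    obtain w where w: "w \<in> S0" "s = D *v w" using s unfolding S by blast
    then have "s = D_S0 *v w" by (simp add: D_S0 closest_point_self)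
    then have "D_S0 *v ?Q s = s" by (intro pinv_right_inverse) simp
    then show ?thesis using Q_S0[of s] by (simp add: D_S0 closest_point_self)
  qed
  note expand = assms(2,4-8,10,14-18)
  show ?thesis
    unfolding expand
  proof (rule PSFL_comp_adjoint[where D = ?D and Q = ?Q, unfolded adj])
    show "linear ?D" "linear ?Q" by simp_all
    show "?Q s \<in> model_S J0 (transpose D *v x)" for s
      using Q_S0 unfolding expand .
    show "?D (?Q s) = s" if "s \<in> model_S (\<lambda>y. J0 (transpose D *v y)) x" for s
      using D_Q that unfolding expand .
    show "is_gauge \<Gamma>" "finite_on UNIV \<Gamma>" "0 \<le> \<nu>" by fact+
  qed (use assms(3,13,20) in \<open>simp_all only: expand\<close>)
qed

end
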